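(* Let $X$ be a Banach space that is Plichko and has countable Szlenk index, i.e. $\mathrm{Sz}(X)<\omega_1$. Then $X$ is weakly compactly generated.
   Context: Banach spaces are over $\mathbb{R}$; $B_{X^*}$ is the closed unit ball of the dual $X^*$, and $w^*$ denotes the weak$^*$ topology. M-basis: a family $\{e_\alpha;\varphi_\alpha\}_{\alpha\in\Gamma}\subseteq X\times X^*$ such that $\langle\varphi_\alpha,e_\beta\rangle=\delta_{\alpha,\beta}$ for all $\alpha,\beta\in\Gamma$, $\mathrm{span}\{e_\alpha\}_{\alpha\in\Gamma}$ is norm-dense in $X$, and $\mathrm{span}\{\varphi_\alpha\}_{\alpha\in\Gamma}$ is $w^*$-dense in $X^*$. $\lambda$-norming subspace: for $0<\lambda\le 1$, a linear subspace $Z\subseteq X^*$ is $\lambda$-norming if $\lambda\|x\|\le\sup\{|\langle\varphi,x\rangle|:\varphi\in Z,\ \|\varphi\|\le 1\}$ for all $x\in X$. Plichko space: $X$ is $\lambda$-Plichko if it admits an M-basis $\{e_\alpha;\varphi_\alpha\}_{\alpha\in\Gamma}$ such that the subspace $\{\varphi\in X^*: \{\alpha\in\Gamma:\langle\varphi,e_\alpha\rangle\ne 0\}\text{ is at most countable}\}$ is $\lambda$-norming. $X$ is Plichko if it is $\lambda$-Plichko for some $\lambda\in(0,1]$. Weakly compactly generated: there is a weakly compact set $K\subseteq X$ whose linear span is norm-dense in $X$. Szlenk index: for a $w^*$-compact set $K\subseteq X^*$ and $\varepsilon>0$, $s_\varepsilon(K)$ is the set obtained by removing from $K$ all relatively $w^*$-open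 subsets of $K$ of norm-diameter less than $\varepsilon$. Put $s_\varepsilon^0(K)=K$, $s_\varepsilon^{\alpha+1}(K)=s_\varepsilon(s_\varepsilon^\alpha(K))$, and $s_\varepsilon^\alpha(K)=\bigcap_{\beta<\alpha}s_\varepsilon^\beta(K)$ for limit ordinals $\alpha$. Let $\mathrm{Sz}(K,\varepsilon)$ be the least ordinal $\alpha$ with $s_\varepsilon^\alpha(K)=\emptyset$ if such an $\alpha$ exists, and $\mathrm{Sz}(K,\varepsilon)=\infty$ otherwise. Then $\mathrm{Sz}(K)=\sup_{\varepsilon>0}\mathrm{Sz}(K,\varepsilon)$ and $\mathrm{Sz}(X)=\mathrm{Sz}(B_{X^*})$. *)

theory Defs
  imports "HOL-Analysis.Analysis" "HOL-Library.Extended"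
begin

section \<open>Ordinals\<close>

text \<open>
  The ordinals that are order types of well-orders of subsets of \<open>'a\<close>, as isomorphism classes.
  Partial equivalence: \<^const>\<open>ordIso\<close> relates only well-orders.
\<close>

quotient_type 'a ordinal = "'a rel" / partial: "\<lambda>r s. (r, s) \<in> ordIso"
proof (rule part_equivpI)
  have "Well_order ({} :: 'a rel)" by simp
  then show "\<exists>r :: 'a rel. (r, r) \<in> ordIso" by (blast intro: ordIso_reflexive)
  show "symp (\<lambda>r s :: 'a rel. (r, s) \<in> ordIso)" by (rule sympI) (rule ordIso_symmetric)
  show "transp (\<lambda>r s :: 'a rel. (r, s) \<in> ordIso)" by (rule transpI) (rule ordIso_transitive)
qed

instantiation ordinal :: (type) linorder
begin

lift_definition less_eq_ordinal :: "'a ordinal \<Rightarrow> 'a ordinal \<Rightarrow> bool" is "\<lambda>r s. (r, s) \<in> ordLeq"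
proof -
  fix r r' s s' :: "'a rel"
  assume "(r, r') \<in> ordIso" "(s, s') \<in> ordIso"
  then show "(r, s) \<in> ordLeq \<longleftrightarrow> (r', s') \<in> ordLeq"
    using ordIso_symmetric[of r r'] ordIso_symmetric[of s s']
      ordIso_ordLeq_trans[of r r' s'] ordLeq_ordIso_trans[of r s s']
      ordIso_ordLeq_trans[of r' r s] ordLeq_ordIso_trans[of r' s' s]
      ordIso_ordLeq_trans[of r r' s] ordLeq_ordIso_trans[of r' s s'] by argo
qed

lift_definition less_ordinal :: "'a ordinal \<Rightarrow> 'a ordinal \<Rightarrow> bool" is "\<lambda>r s. (r, s) \<in> ordLess"
proof -
  fix r r' s s' :: "'a rel"
  assume "(r, r') \<in> ordIso" "(s, s') \<in> ordIso"
  then show "(r, s) \<in> ordLess \<longleftrightarrow> (r', s') \<in> ordLess"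
    using ordIso_symmetric[of r r'] ordIso_symmetric[of s s']
      ordIso_ordLess_trans[of r r' s'] ordLess_ordIso_trans[of r s s']
      ordIso_ordLess_trans[of r' r s] ordLess_ordIso_trans[of r' s' s]
      ordIso_ordLess_trans[of r r' s] ordLess_ordIso_trans[of r' s s'] by argo
qed

instance
proof
  fix x y z :: "'a ordinal"
  show "x < y \<longleftrightarrow> x \<le> y \<and> \<not> y \<le> x"
  proof transfer
    fix r s :: "'a rel"
    assume "(r, r) \<in> ordIso" "(s, s) \<in> ordIso"
    then have "Well_order r" "Well_order s"
      by (simp_all add: ordIso_def)
    then show "(r, s) \<in> ordLess \<longleftrightarrow> (r, s) \<in> ordLeq \<and> (s, r) \<notin> ordLeq"
      using not_ordLeq_iff_ordLess ordLess_imp_ordLeq by blast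
  qed
  show "x \<le> x" by transfer (rule ordIso_imp_ordLeq)
  show "x \<le> z" if "x \<le> y" "y \<le> z"
    using that by transfer (rule ordLeq_transitive)
  show "x = y" if "x \<le> y" "y \<le> x"
    using that by transfer (simp add: ordIso_iff_ordLeq)
  show "x \<le> y \<or> y \<le> x"
    by transfer (simp add: ordIso_def ordLeq_total)
qed

end

lemma ordinal_cases:
  obtains r where "(r, r) \<in> ordIso" "a = abs_ordinal r"
  using Quotient3_rep_reflp[OF Quotient3_ordinal, of a]
    Quotient3_abs_rep[OF Quotient3_ordinal, of a] by (rule that[OF _ sym])

instance ordinal :: (type) wellorder
proof
  fix P :: "'a ordinal \<Rightarrow> bool" and a :: "'a ordinal"
  assume step: "\<And>x. (\<And>y. y < x \<Longrightarrow> P y) \<Longrightarrow> P x"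
  have "(r, r) \<in> ordIso \<longrightarrow> P (abs_ordinal r)" for r :: "'a rel"
  proof (induction r rule: wf_induct_rule[OF wf_ordLess])
    case (1 r)
    show ?case
    proof
      assume r: "(r, r) \<in> ordIso"
      show "P (abs_ordinal r)"
      proof (rule step)
        fix y assume y: "y < abs_ordinal r"
        obtain s where s: "(s, s) \<in> ordIso" "y = abs_ordinal s"
          by (cases y rule: ordinal_cases)
        then have "(s, r) \<in> ordLess" using y r by (simp add: less_ordinal.abs_eq)
        then show "P y" using 1 s by blast
      qed
    qed
  qed
  moreover obtain s where "(s, s) \<in> ordIso" "a = abs_ordinal s"
    by (cases a rule: ordinal_cases)
  ultimately show "P a" by blast
qed

text \<open>
  The summand \<open>nat set\<close> guarantees that \<open>\<omega>\<^sub>1\<close>, which the library provides as the well-order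
  \<open>cardSuc natLeq\<close> on \<open>nat set\<close>, is among the ordinals considered.
\<close>

lift_definition omega_1 :: "('a + nat set) ordinal" is "dir_image (cardSuc natLeq) Inr"
  by (intro ordIso_reflexive Well_order_dir_image card_order_on_well_order_on
      cardSuc_Card_order natLeq_Card_order) simp

lemma less_omega_1_iff:
  fixes r :: "('a + nat set) rel"
  assumes r: "Well_order r"
  shows "abs_ordinal r < omega_1 \<longleftrightarrow> countable (Field r)"
proof -
  let ?c = "cardSuc natLeq"
  have c: "Card_order ?c" "Well_order ?c"
    by (simp_all add: cardSuc_Card_order natLeq_Card_order card_order_on_well_order_on)
  have iso: "(?c, dir_image ?c (Inr :: _ \<Rightarrow> 'a + nat set)) \<in> ordIso"
    using c(2) by (intro dir_image_ordIso) auto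
  have "abs_ordinal r < omega_1 \<longleftrightarrow> (r, dir_image ?c (Inr :: _ \<Rightarrow> 'a + nat set)) \<in> ordLess"
    unfolding omega_1_def
    by (rule less_ordinal.abs_eq)
      (use r c in \<open>auto intro!: ordIso_reflexive Well_order_dir_image\<close>)
  also have "\<dots> \<longleftrightarrow> (r, ?c) \<in> ordLess"
    by (rule iffI; erule ordLess_ordIso_trans) (use iso ordIso_symmetric[OF iso] in auto)
  also have "\<dots> \<longleftrightarrow> (card_of (Field r), ?c) \<in> ordLess"
  proof
    assume "(r, ?c) \<in> ordLess"
    moreover have "(card_of (Field r), r) \<in> ordLeq"
      using r by (rule card_of_least)
    ultimately show "(card_of (Field r), ?c) \<in> ordLess"
      by (rule ordLeq_ordLess_trans[rotated])
  next
    assume a: "(card_of (Field r), ?c) \<in> ordLess"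
    show "(r, ?c) \<in> ordLess"
    proof (rule ccontr)
      assume "(r, ?c) \<notin> ordLess"
      then have "(?c, r) \<in> ordLeq"
        using not_ordLess_iff_ordLeq[OF c(2) r] by blast
      then have "(card_of (Field ?c), card_of (Field r)) \<in> ordLeq"
        by (rule card_of_mono2)
      with card_of_Field_ordIso[OF c(1)] have "(?c, card_of (Field r)) \<in> ordLeq"
        using ordIso_symmetric ordIso_ordLeq_trans by blast
      with a show False using not_ordLess_ordLeq by blast
    qed
  qed
  also have "\<dots> \<longleftrightarrow> (card_of (Field r), natLeq) \<in> ordLeq"
    by (rule cardSuc_ordLeq_ordLess) (simp_all add: natLeq_Card_order card_of_Card_order)
  also have "\<dots> \<longleftrightarrow> (card_of (Field r), card_of (UNIV :: nat set)) \<in> ordLeq"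
    by (rule iffI; erule ordLeq_ordIso_trans) (simp_all add: card_of_nat ordIso_symmetric)
  also have "\<dots> \<longleftrightarrow> countable (Field r)"
    by (simp add: card_of_ordLeq[symmetric] countable_def)
  finally show ?thesis .
qed

section \<open>Weak and weak-star topologies\<close>

text \<open>
  The library's strong operator topology is the topology of pointwise convergence; for
  functionals this is the weak-star topology.
\<close>

abbreviation weak_star_topology :: "('a::real_normed_vector \<Rightarrow>\<^sub>L real) topology" where
  "weak_star_topology \<equiv> strong_operator_topology"

definition weak_topology :: "'a::real_normed_vector topology" where
  "weak_topology =
     pullback_topology UNIV (\<lambda>x (\<phi> :: 'a \<Rightarrow>\<^sub>L real). blinfun_apply \<phi> x) euclidean"

definition weakly_compactly_generated :: "'a::banach itself \<Rightarrow> bool" where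
  "weakly_compactly_generated _ \<longleftrightarrow>
     (\<exists>K :: 'a set. compactin weak_topology K \<and> closure (span K) = UNIV)"

section \<open>Plichko spaces\<close>

definition M_basis ::
  "'i set \<Rightarrow> ('i \<Rightarrow> 'a::banach) \<Rightarrow> ('i \<Rightarrow> 'a \<Rightarrow>\<^sub>L real) \<Rightarrow> bool" where
  "M_basis \<Gamma> e \<phi> \<longleftrightarrow>
     (\<forall>\<alpha>\<in>\<Gamma>. \<forall>\<beta>\<in>\<Gamma>. blinfun_apply (\<phi> \<alpha>) (e \<beta>) = (if \<alpha> = \<beta> then 1 else 0)) \<and>
     closure (span (e ` \<Gamma>)) = UNIV \<and>
     weak_star_topology closure_of (span (\<phi> ` \<Gamma>)) = UNIV"

definition norming :: "real \<Rightarrow> ('a::banach \<Rightarrow>\<^sub>L real) set \<Rightarrow> bool" where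
  "norming c Z \<longleftrightarrow> 0 < c \<and> c \<le> 1 \<and> subspace Z \<and>
     (\<forall>x. c * norm x \<le> (SUP \<phi>\<in>{\<phi>\<in>Z. norm \<phi> \<le> 1}. \<bar>blinfun_apply \<phi> x\<bar>))"

definition countably_supported :: "'i set \<Rightarrow> ('i \<Rightarrow> 'a::banach) \<Rightarrow> ('a \<Rightarrow>\<^sub>L real) set" where
  "countably_supported \<Gamma> e = {\<phi>. countable {\<alpha>\<in>\<Gamma>. blinfun_apply \<phi> (e \<alpha>) \<noteq> 0}}"

text \<open>
  Biorthogonality makes \<open>e\<close> injective on the index set, so indexing by subsets of the space itself
  is no restriction; see \<open>Plichko_constI\<close> below.
\<close>

definition Plichko_const :: "real \<Rightarrow> 'a::banach itself \<Rightarrow> bool" where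
  "Plichko_const c _ \<longleftrightarrow>
     (\<exists>(\<Gamma> :: 'a set) (e :: 'a \<Rightarrow> 'a) \<phi>. M_basis \<Gamma> e \<phi> \<and> norming c (countably_supported \<Gamma> e))"

definition Plichko :: "'a::banach itself \<Rightarrow> bool" where
  "Plichko T \<longleftrightarrow> (\<exists>c. 0 < c \<and> c \<le> 1 \<and> Plichko_const c T)"

lemma Plichko_constI:
  fixes e :: "'i \<Rightarrow> 'a::banach"
  assumes "M_basis \<Gamma> e \<phi>" and "norming c (countably_supported \<Gamma> e)"
  shows "Plichko_const c TYPE('a)"
proof -
  have inj: "inj_on e \<Gamma>"
  proof (rule inj_onI)
    fix \<alpha> \<beta> assume "\<alpha> \<in> \<Gamma>" "\<beta> \<in> \<Gamma>" "e \<alpha> = e \<beta>"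
    then show "\<alpha> = \<beta>"
      using assms(1) unfolding M_basis_def by (metis zero_neq_one)
  qed
  let ?\<psi> = "\<phi> \<circ> inv_into \<Gamma> e"
  have im: "?\<psi> ` (e ` \<Gamma>) = \<phi> ` \<Gamma>"
    using inj by (force simp: image_image)
  have "M_basis (e ` \<Gamma>) id ?\<psi>"
    using assms(1) im inj unfolding M_basis_def by (auto simp: inj_on_eq_iff)
  moreover have "countably_supported (e ` \<Gamma>) id = countably_supported \<Gamma> e"
  proof -
    have "{x \<in> e ` \<Gamma>. blinfun_apply f x \<noteq> 0} = e ` {\<alpha>\<in>\<Gamma>. blinfun_apply f (e \<alpha>) \<noteq> 0}"
        for f :: "'a \<Rightarrow>\<^sub>L real"
      by auto
    then show ?thesis
      unfolding countably_supported_def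
      using countable_image_inj_eq[OF inj_on_subset[OF inj]] by simp
  qed
  ultimately show ?thesis
    using assms(2) unfolding Plichko_const_def
    by (intro exI[of _ "e ` \<Gamma>"] exI[of _ id] exI[of _ ?\<psi>]) simp
qed

section \<open>Szlenk index\<close>

text \<open>
  \<^const>\<open>diameter\<close> is a real-valued supremum and hence meaningless for unbounded sets.
\<close>

definition szlenk_derivation ::
  "real \<Rightarrow> ('a::banach \<Rightarrow>\<^sub>L real) set \<Rightarrow> ('a \<Rightarrow>\<^sub>L real) set" where
  "szlenk_derivation \<epsilon> K =
     K - \<Union>{U. openin (subtopology weak_star_topology K) U \<and> bounded U \<and> diameter U < \<epsilon>}"

definition is_succ :: "'o::wellorder \<Rightarrow> 'o \<Rightarrow> bool" where
  "is_succ \<beta> \<alpha> \<longleftrightarrow> \<beta> < \<alpha> \<and> (\<forall>\<gamma><\<alpha>. \<gamma> \<le> \<beta>)"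

lemma is_succ_unique: "is_succ \<beta> \<alpha> \<Longrightarrow> is_succ \<gamma> \<alpha> \<Longrightarrow> \<gamma> = \<beta>"
  unfolding is_succ_def by (meson antisym)

function szlenk_iter ::
  "real \<Rightarrow> ('a::banach \<Rightarrow>\<^sub>L real) set \<Rightarrow> 'o::wellorder \<Rightarrow> ('a \<Rightarrow>\<^sub>L real) set" where
  "szlenk_iter \<epsilon> K \<alpha> =
     (if \<forall>\<beta>. \<alpha> \<le> \<beta> then K
      else if \<exists>\<beta>. is_succ \<beta> \<alpha> then szlenk_derivation \<epsilon> (szlenk_iter \<epsilon> K (THE \<beta>. is_succ \<beta> \<alpha>))
      else (\<Inter>\<beta>\<in>{..<\<alpha>}. szlenk_iter \<epsilon> K \<beta>))"
  by pat_completeness auto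
termination
proof (relation "inv_image {(\<beta>, \<alpha>). \<beta> < \<alpha>} (\<lambda>(_, _, \<alpha>). \<alpha>)")
  fix \<epsilon> :: real and K :: "('a \<Rightarrow>\<^sub>L real) set" and \<alpha> :: "'o::wellorder"
  assume "\<exists>\<beta>. is_succ \<beta> \<alpha>"
  then have "is_succ (THE \<beta>. is_succ \<beta> \<alpha>) \<alpha>"
    by (metis is_succ_unique theI')
  then show "((\<epsilon>, K, THE \<beta>. is_succ \<beta> \<alpha>), \<epsilon>, K, \<alpha>) \<in> inv_image {(\<beta>, \<alpha>). \<beta> < \<alpha>} (\<lambda>(_, _, \<alpha>). \<alpha>)"
    by (simp add: is_succ_def)
qed (auto simp: wf)

declare szlenk_iter.simps [simp del]

lemma szlenk_iter_zero: "(\<And>\<beta>. \<alpha> \<le> \<beta>) \<Longrightarrow> szlenk_iter \<epsilon> K \<alpha> = K"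
  by (subst szlenk_iter.simps) simp

lemma szlenk_iter_succ:
  assumes "is_succ \<beta> \<alpha>"
  shows "szlenk_iter \<epsilon> K \<alpha> = szlenk_derivation \<epsilon> (szlenk_iter \<epsilon> K \<beta>)"
proof -
  have "(THE \<beta>. is_succ \<beta> \<alpha>) = \<beta>"
    using assms is_succ_unique by blast
  moreover have "\<not> (\<forall>\<beta>. \<alpha> \<le> \<beta>)"
    using assms unfolding is_succ_def by (metis not_le)
  ultimately show ?thesis
    using assms by (subst szlenk_iter.simps) auto
qed

lemma szlenk_iter_limit:
  assumes "\<gamma> < \<alpha>" and "\<And>\<beta>. \<not> is_succ \<beta> \<alpha>"
  shows "szlenk_iter \<epsilon> K \<alpha> = (\<Inter>\<beta>\<in>{..<\<alpha>}. szlenk_iter \<epsilon> K \<beta>)"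
proof -
  have "\<not> (\<forall>\<beta>. \<alpha> \<le> \<beta>)"
    using assms(1) by (metis not_le)
  then show ?thesis
    using assms(2) by (subst szlenk_iter.simps) auto
qed

text \<open>
  As long as the derived sets have not stabilised they decrease strictly, so the first ordinal at
  which they are empty, if any, is the order type of a well-order of a subset of the dual. Hence the
  following ordinals suffice for the index at a fixed \<open>\<epsilon>\<close>; they are closed under
  countable suprema, hence suffice also for the supremum over \<open>\<epsilon> > 0\<close>,
  which may be taken along \<open>\<epsilon> = 1/n\<close> by monotonicity. The value \<^const>\<open>Pinf\<close> means that the derived sets are never empty;
  \<^const>\<open>Minf\<close> is not attained.
\<close>

type_synonym 'a szlenk_ordinal = "(('a \<Rightarrow>\<^sub>L real) + nat set) ordinal"

definition szlenk_index_eps ::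
  "('a::banach \<Rightarrow>\<^sub>L real) set \<Rightarrow> real \<Rightarrow> 'a szlenk_ordinal extended" where
  "szlenk_index_eps K \<epsilon> =
     (if \<exists>\<alpha> :: 'a szlenk_ordinal. szlenk_iter \<epsilon> K \<alpha> = {}
      then Fin (LEAST \<alpha>. szlenk_iter \<epsilon> K \<alpha> = {}) else Pinf)"

text \<open>The supremum, written as the least upper bound; it exists by well-ordering.\<close>

definition szlenk_index :: "('a::banach \<Rightarrow>\<^sub>L real) set \<Rightarrow> 'a szlenk_ordinal extended" where
  "szlenk_index K = (LEAST \<alpha>. \<forall>\<epsilon>>0. szlenk_index_eps K \<epsilon> \<le> \<alpha>)"

definition Sz :: "'a::banach itself \<Rightarrow> 'a szlenk_ordinal extended" where
  "Sz _ = szlenk_index (cball 0 1 :: ('a \<Rightarrow>\<^sub>L real) set)"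

lemma szlenk_index_is_sup:
  "0 < \<epsilon> \<Longrightarrow> szlenk_index_eps K \<epsilon> \<le> szlenk_index K"
  "(\<And>\<epsilon>. 0 < \<epsilon> \<Longrightarrow> szlenk_index_eps K \<epsilon> \<le> \<alpha>) \<Longrightarrow> szlenk_index K \<le> \<alpha>"
proof -
  let ?P = "\<lambda>\<alpha>. \<forall>\<epsilon>>0. szlenk_index_eps K \<epsilon> \<le> \<alpha>"
  have nM: "\<not> ?P Minf"
  proof
    assume "?P Minf"
    then have "szlenk_index_eps K 1 \<le> Minf" by simp
    then show False by (simp add: szlenk_index_eps_def split: if_splits)
  qed
  have "\<exists>a. ?P a \<and> (\<forall>b. ?P b \<longrightarrow> a \<le> b)"
  proof (cases "\<exists>x. ?P (Fin x)")
    case True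
    then have "?P (Fin (LEAST x. ?P (Fin x)))"
      by (rule LeastI_ex)
    moreover have "Fin (LEAST x. ?P (Fin x)) \<le> b" if b: "?P b" for b
    proof (cases b)
      case (Fin y)
      then have "(LEAST x. ?P (Fin x)) \<le> y"
        using b by (auto intro!: Least_le)
      then show ?thesis using Fin by simp
    qed (use b nM in auto)
    ultimately show ?thesis by blast
  next
    case False
    have "Pinf \<le> b" if b: "?P b" for b
      using b False nM by (cases b) auto
    moreover have "?P Pinf" by simp
    ultimately show ?thesis by blast
  qed
  then obtain a where a: "?P a" "\<And>b. ?P b \<Longrightarrow> a \<le> b" by blast
  then have eq: "szlenk_index K = a"
    unfolding szlenk_index_def by (intro Least_equality) auto
  show "0 < \<epsilon> \<Longrightarrow> szlenk_index_eps K \<epsilon> \<le> szlenk_index K"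
    using a eq by blast
  show "(\<And>\<epsilon>. 0 < \<epsilon> \<Longrightarrow> szlenk_index_eps K \<epsilon> \<le> \<alpha>) \<Longrightarrow> szlenk_index K \<le> \<alpha>"
    using a eq by blast
qed

end

theory Submission
  imports Defs
begin

text \<open>
  Let \<open>B\<close> be the M-basis and \<open>K\<close> the dual unit ball of the equivalent norm \<open>p\<close> given by the
  countably supported functionals of norm at most 1. A closing-off argument assigns to finite sets
  \<open>F \<subseteq> B\<close> countable sets \<open>C F \<subseteq> B\<close> such that every \<open>C\<close>-closed \<open>D \<subseteq> B\<close> admits a
  \<open>p\<close>-contractive projection onto the closed span of \<open>D\<close> that kills \<open>B - D\<close> and whose adjoint maps
  all Szlenk derivatives of \<open>K\<close> into themselves; only countably many derivatives have to be taken
  into account because the Szlenk index is countable. As every functional leaves the derivatives at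
  some stage, its restrictions to \<open>C\<close>-closed sets depend norm-continuously on the set. By
  transfinite induction on the cardinality, this yields positive weights \<open>w a\<close> such that
  \<open>{w a *\<^sub>R a | a \<in> B}\<close> is a weakly null family, hence weakly compact together with 0.
\<close>

unbundle cardinal_syntax

section \<open>Sets closed under a countable-valued operation\<close>

text \<open>Testing finite subsets only is what lets closedness pass to unions of chains.\<close>

definition closed_under :: "('a set \<Rightarrow> 'a set) \<Rightarrow> 'a set \<Rightarrow> bool" where
  "closed_under C D \<longleftrightarrow> (\<forall>F. finite F \<and> F \<subseteq> D \<longrightarrow> C F \<subseteq> D)"

lemma closed_underD: "closed_under C D \<Longrightarrow> finite F \<Longrightarrow> F \<subseteq> D \<Longrightarrow> C F \<subseteq> D"
  by (auto simp: closed_under_def)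

lemma closed_under_Inter:
  assumes "\<And>D. D \<in> \<D> \<Longrightarrow> closed_under C D"
  shows "closed_under C (\<Inter>\<D>)"
  using assms unfolding closed_under_def by blast

lemma chain_finite_subset:
  assumes "finite F" "F \<subseteq> (\<Union>i\<in>I. D i)" "I \<noteq> {}"
    and chain: "\<And>i j. i \<in> I \<Longrightarrow> j \<in> I \<Longrightarrow> D i \<subseteq> D j \<or> D j \<subseteq> D i"
  shows "\<exists>i\<in>I. F \<subseteq> D i"
  using assms(1,2)
proof induction
  case empty
  then show ?case using \<open>I \<noteq> {}\<close> by blast
next
  case (insert x F)
  then obtain i j where "i \<in> I" "F \<subseteq> D i" "j \<in> I" "x \<in> D j" by auto
  then show ?case using chain[of i j] by blast
qed

text \<open>A finite subset of the union already lies in one member of the chain. The chain must be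
  nonempty because \<open>C {}\<close> has to be covered.\<close>

lemma closed_under_chain_Union:
  assumes "\<And>i. i \<in> I \<Longrightarrow> closed_under C (D i)" "I \<noteq> {}"
    and "\<And>i j. i \<in> I \<Longrightarrow> j \<in> I \<Longrightarrow> D i \<subseteq> D j \<or> D j \<subseteq> D i"
  shows "closed_under C (\<Union>i\<in>I. D i)"
  unfolding closed_under_def
proof (intro allI impI)
  fix F assume F: "finite F \<and> F \<subseteq> (\<Union>i\<in>I. D i)"
  then obtain i where "i \<in> I" "F \<subseteq> D i"
    using chain_finite_subset[of F D I] assms(2,3) by blast
  then show "C F \<subseteq> (\<Union>i\<in>I. D i)"
    using closed_underD[OF assms(1)] F by blast
qed

section \<open>Cardinality of closed hulls\<close>

lemma card_of_finite_subsets: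
  assumes inf: "infinite B" and A: "|A| \<le>o |B|"
  shows "|{F. finite F \<and> F \<subseteq> A}| \<le>o |B|"
proof -
  define G where "G n = {F. finite F \<and> F \<subseteq> A \<and> card F = n}" for n :: nat
  have "|G n| \<le>o |B|" for n
  proof (induction n)
    case 0
    have "G 0 = {{}}" by (auto simp: G_def)
    then show ?case using inf by (simp add: card_of_singl_ordLeq infinite_imp_nonempty)
  next
    case (Suc n)
    \<comment> \<open>A set of size \<open>Suc n\<close> is a set of size \<open>n\<close> with one
      point inserted, and products do not exceed the infinite cardinal \<open>|B|\<close>.\<close>
    have "G (Suc n) \<subseteq> (\<lambda>(a, F). insert a F) ` (A \<times> G n)"
    proof
      fix F assume "F \<in> G (Suc n)"
      then have F: "finite F" "F \<subseteq> A" "card F = Suc n" by (auto simp: G_def)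
      then obtain a where a: "a \<in> F" by fastforce
      have "F - {a} \<in> G n" using F a by (auto simp: G_def)
      moreover have "F = insert a (F - {a})" using a by blast
      ultimately show "F \<in> (\<lambda>(a, F). insert a F) ` (A \<times> G n)"
        using F a by (intro image_eqI[of _ _ "(a, F - {a})"]) auto
    qed
    then have "|G (Suc n)| \<le>o |A \<times> G n|"
      using card_of_mono1 card_of_image ordLeq_transitive by blast
    moreover have "|A \<times> G n| \<le>o |B|"
      by (rule card_of_Sigma_ordLeq_infinite[OF inf A]) (simp add: Suc)
    ultimately show ?case by (rule ordLeq_transitive)
  qed
  moreover have "|UNIV :: nat set| \<le>o |B|"
    using inf infinite_iff_card_of_nat by blast
  ultimately have "|\<Union>n. G n| \<le>o |B|"
    using card_of_UNION_ordLeq_infinite[OF inf, of UNIV G] by blast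
  moreover have "{F. finite F \<and> F \<subseteq> A} = (\<Union>n. G n)"
    by (auto simp: G_def)
  ultimately show ?thesis by simp
qed

definition hull_under :: "('a set \<Rightarrow> 'a set) \<Rightarrow> 'a set \<Rightarrow> 'a set" where
  "hull_under C A = \<Inter>{D. closed_under C D \<and> A \<subseteq> D}"

lemma closed_under_hull: "closed_under C (hull_under C A)"
  unfolding hull_under_def by (intro closed_under_Inter) auto

lemma hull_under_superset: "A \<subseteq> hull_under C A"
  by (auto simp: hull_under_def)

lemma hull_under_least: "closed_under C D \<Longrightarrow> A \<subseteq> D \<Longrightarrow> hull_under C A \<subseteq> D"
  by (auto simp: hull_under_def)

lemma hull_under_mono: "A \<subseteq> A' \<Longrightarrow> hull_under C A \<subseteq> hull_under C A'"
  by (auto simp: hull_under_def)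

text \<open>Countably many rounds of adding the values of \<open>C\<close> on finite subsets reach a
  closed set, and each round keeps the size at most \<open>|B|\<close>. The bound \<open>B\<close>
  has a type of its own, so that the naturals can serve when \<open>A\<close> is countable.\<close>

lemma card_of_hull_under:
  fixes C :: "'a set \<Rightarrow> 'a set" and B :: "'b set"
  assumes C: "\<And>F. countable (C F)" and inf: "infinite B" and A: "|A| \<le>o |B|"
  shows "|hull_under C A| \<le>o |B|"
proof -
  define step where "step A = A \<union> (\<Union>F\<in>{F. finite F \<and> F \<subseteq> A}. C F)" for A
  define S where "S n = (step ^^ n) A" for n
  have S_Suc: "S (Suc n) = step (S n)" for n by (simp add: S_def)
  have mono: "S m \<subseteq> S n" if "m \<le> n" for m n
    using that by (rule lift_Suc_mono_le[rotated]) (auto simp: S_Suc step_def)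
  have nat: "|UNIV :: nat set| \<le>o |B|"
    using inf infinite_iff_card_of_nat by blast
  have CB: "|C F| \<le>o |B|" for F
  proof -
    have "|C F| \<le>o |UNIV :: nat set|"
      using C[of F] unfolding countable_def card_of_ordLeq[symmetric] by auto
    then show ?thesis using nat ordLeq_transitive by blast
  qed
  have "|S n| \<le>o |B|" for n
  proof (induction n)
    case 0
    then show ?case using A by (simp add: S_def)
  next
    case (Suc n)
    have "|\<Union>F\<in>{F. finite F \<and> F \<subseteq> S n}. C F| \<le>o |B|"
      using card_of_UNION_ordLeq_infinite[OF inf card_of_finite_subsets[OF inf Suc]] CB by blast
    then show ?case
      unfolding S_Suc step_def using inf Suc
      by (intro card_of_Un_ordLeq_infinite_Field) (auto simp: card_of_card_order_on Field_card_of)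
  qed
  then have "|\<Union>n. S n| \<le>o |B|"
    using card_of_UNION_ordLeq_infinite[OF inf nat] by blast
  moreover have "hull_under C A \<subseteq> (\<Union>n. S n)"
  proof (rule hull_under_least)
    show "closed_under C (\<Union>n. S n)"
      unfolding closed_under_def
    proof (intro allI impI)
      fix F assume F: "finite F \<and> F \<subseteq> (\<Union>n. S n)"
      have "\<exists>n\<in>UNIV. F \<subseteq> S n"
        using F mono by (intro chain_finite_subset) (auto, meson linear subsetD)
      then obtain n where "F \<subseteq> S n" by blast
      then have "C F \<subseteq> S (Suc n)"
        using F by (auto simp: S_Suc step_def)
      then show "C F \<subseteq> (\<Union>n. S n)" by blast
    qed
    show "A \<subseteq> (\<Union>n. S n)"
      using UN_upper[of 0 UNIV S] by (simp add: S_def)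
  qed
  ultimately show ?thesis
    using card_of_mono1 ordLeq_transitive by blast
qed

text \<open>The points of \<open>S\<close> with finitely many predecessors in \<open>S\<close> form
  the required set: were there finitely many of them, the least remaining point would also have
  finitely many predecessors.\<close>

lemma well_order_infinite_no_max:
  assumes r: "Well_order r" and S: "infinite S" "S \<subseteq> Field r"
  obtains T where "T \<subseteq> S" "T \<noteq> {}" "\<And>m. m \<in> T \<Longrightarrow> \<exists>x\<in>T. (x, m) \<notin> r"
proof -
  define T where "T = {x \<in> S. finite (S \<inter> under r x)}"
  have "infinite T"
  proof
    assume fin: "finite T"
    then have "S - T \<noteq> {}" using S(1) by (metis Diff_eq_empty_iff finite_subset)
    then obtain x where x: "x \<in> S - T" and min: "\<And>y. y \<in> S - T \<Longrightarrow> (x, y) \<in> r"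
      using wo_rel.minim_in[of r "S - T"] wo_rel.minim_least[of r "S - T"] r S(2)
      by (metis Diff_subset subset_trans wo_rel.intro)
    have "S \<inter> under r x \<subseteq> insert x T"
    proof
      fix y assume y: "y \<in> S \<inter> under r x"
      show "y \<in> insert x T"
      proof (rule ccontr)
        assume "y \<notin> insert x T"
        then have "(x, y) \<in> r" "(y, x) \<in> r" "y \<noteq> x" using y min by (auto simp: under_def)
        then show False using r by (meson antisymD well_order_on_def linear_order_on_def partial_order_on_def)
      qed
    qed
    then have "finite (S \<inter> under r x)" using fin finite_subset by blast
    then show False using x by (auto simp: T_def)
  qed
  moreover have "\<exists>x\<in>T. (x, m) \<notin> r" if "m \<in> T" for m
  proof (rule ccontr)
    assume "\<not> ?thesis"
    then have "T \<subseteq> S \<inter> under r m" by (auto simp: T_def under_def)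
    moreover have "finite (S \<inter> under r m)" using that by (auto simp: T_def)
    ultimately show False using \<open>infinite T\<close> finite_subset by blast
  qed
  moreover have "T \<subseteq> S" by (auto simp: T_def)
  ultimately show ?thesis
    using that[of T] by (metis finite.emptyI)
qed

section \<open>Weights that turn bounded functions into null families\<close>

lemma countable_null_weights:
  fixes u :: "'f \<Rightarrow> 'a \<Rightarrow> real"
  assumes A: "countable A" and u: "\<And>f a. f \<in> \<F> \<Longrightarrow> u f a \<le> 1"
  shows "\<exists>w. (\<forall>a. 0 < w a \<and> w a \<le> 1) \<and>
    (\<forall>f\<in>\<F>. \<forall>\<epsilon>>0. finite {a\<in>A. \<epsilon> \<le> w a * u f a})"
proof -
  \<comment> \<open>Weights tending to 0 along an enumeration suffice, since all \<open>u f\<close>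
    share the bound 1.\<close>
  define w :: "'a \<Rightarrow> real" where "w a = inverse (real (Suc (to_nat_on A a)))" for a
  have "finite {a\<in>A. \<epsilon> \<le> w a * u f a}" if f: "f \<in> \<F>" and "\<epsilon> > 0" for f and \<epsilon> :: real
  proof -
    obtain n where n: "inverse (real (Suc n)) < \<epsilon>"
      using reals_Archimedean[OF \<open>\<epsilon> > 0\<close>] by blast
    have "to_nat_on A a < n" if "a \<in> A" "\<epsilon> \<le> w a * u f a" for a
    proof (rule ccontr)
      assume "\<not> to_nat_on A a < n"
      then have "w a \<le> inverse (real (Suc n))"
        unfolding w_def by (intro le_imp_inverse_le) auto
      moreover have "w a * u f a \<le> w a * 1"
        using u[OF f] by (intro mult_left_mono) (auto simp: w_def)
      ultimately show False using n that(2) by simp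
    qed
    then have "to_nat_on A ` {a\<in>A. \<epsilon> \<le> w a * u f a} \<subseteq> {..<n}" by auto
    then show ?thesis
      using finite_subset finite_lessThan inj_on_to_nat_on[OF A]
      by (metis (no_types, lifting) finite_imageD inj_on_subset mem_Collect_eq subsetI)
  qed
  moreover have "0 < w a \<and> w a \<le> 1" for a
    by (auto simp: w_def inverse_le_1_iff)
  ultimately show ?thesis by blast
qed

text \<open>
  Transfinite induction on \<open>|A|\<close>: for uncountable \<open>A\<close>, the hulls of the initial segments of a
  well-order of \<open>A\<close> of minimal type cut \<open>A\<close> into blocks of smaller cardinality, and by \<open>cont\<close>
  each function in \<open>\<F>\<close> exceeds \<open>\<epsilon>\<close> in finitely many blocks only.
\<close>

proposition null_weights:
  fixes u :: "'f \<Rightarrow> 'a \<Rightarrow> real" and A :: "'a set"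
  assumes C: "\<And>F. countable (C F)"
    and u: "\<And>f a. f \<in> \<F> \<Longrightarrow> 0 \<le> u f a \<and> u f a \<le> 1"
    and G: "closed_under C G" "A \<subseteq> G"
    and cont: "\<And>f D \<epsilon>. f \<in> \<F> \<Longrightarrow> closed_under C D \<Longrightarrow> D \<subseteq> G \<Longrightarrow> 0 < \<epsilon> \<Longrightarrow>
      \<exists>F. finite F \<and> F \<subseteq> D \<and>
        (\<forall>D'. closed_under C D' \<and> F \<subseteq> D' \<and> D' \<subseteq> D \<longrightarrow> (\<forall>a\<in>D - D'. u f a < \<epsilon>))"
  shows "\<exists>w. (\<forall>a. 0 < w a \<and> w a \<le> 1) \<and>
    (\<forall>f\<in>\<F>. \<forall>\<epsilon>>0. finite {a\<in>A. \<epsilon> \<le> w a * u f a})"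
  using G(2)
proof (induction A rule: wf_induct_rule[OF wf_inv_image[OF wf_ordLess, of card_of]])
  case (1 A)
  show ?case
  proof (cases "countable A")
    case True
    then show ?thesis using u by (intro countable_null_weights) auto
  next
    case False
    then have inf: "infinite A" using countable_finite by blast
    define r where "r = |A|"
    have r: "Well_order r" "Card_order r" "Field r = A"
      by (simp_all add: r_def card_of_well_order_on card_of_card_order_on Field_card_of)
    have wo: "wo_rel r" using r(1) by (simp add: wo_rel_def)
    define D where "D x = hull_under C (under r x)" for x
    have D_closed: "closed_under C (D x)" for x
      by (simp add: D_def closed_under_hull)
    have under_sub: "under r x \<subseteq> A" for x
      using r(3) by (auto simp: under_def Field_def)
    have D_sub: "D x \<subseteq> G" for x
      unfolding D_def using under_sub[of x] 1(2) G by (intro hull_under_least) auto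
    have D_mono: "D x \<subseteq> D y" if "(x, y) \<in> r" for x y
      unfolding D_def using that wo_rel.TRANS[OF wo]
      by (intro hull_under_mono) (auto simp: under_def dest: transD)
    have tot: "(x, y) \<in> r \<or> (y, x) \<in> r" if "x \<in> A" "y \<in> A" for x y
      using wo_rel.TOTALS[OF wo] that r(3) by blast
    have self: "a \<in> D a" if "a \<in> A" for a
    proof -
      have "a \<in> under r a"
        using wo_rel.TOTALS[OF wo] that r(3) by (auto simp: under_def)
      then show ?thesis unfolding D_def using hull_under_superset[of "under r a" C] by blast
    qed
    \<comment> \<open>\<open>k a\<close> is the first stage whose hull contains \<open>a\<close>.
      The fibres of \<open>k\<close> are the blocks to which the induction hypothesis
      applies.\<close>
    define k where "k a = wo_rel.minim r {x\<in>A. a \<in> D x}" for a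
    have k: "k a \<in> A" "a \<in> D (k a)" if "a \<in> A" for a
      using wo_rel.minim_in[OF wo, of "{x\<in>A. a \<in> D x}"] self[OF that] that r(3)
      by (auto simp: k_def)
    have k_least: "(k a, x) \<in> r" if "x \<in> A" "a \<in> D x" for a x
      using wo_rel.minim_least[OF wo, of "{x\<in>A. a \<in> D x}" x] that r(3)
      by (auto simp: k_def)
    have small: "|D x| <o |A|" if "x \<in> A" for x
    proof -
      have "under r x \<subseteq> insert x (underS r x)"
        by (auto simp: under_def underS_def)
      moreover have "|underS r x| <o |A|"
        using card_of_underS[OF r(2)] that r(3) r_def by simp
      moreover have "|{x}| <o |A|"
        using inf by (intro finite_ordLess_infinite) (auto simp: card_of_well_order_on Field_card_of)
      ultimately have U: "|under r x| <o |A|"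
        using card_of_Un_ordLess_infinite[OF inf, of "underS r x" "{x}"]
          card_of_mono1[of "under r x" "underS r x \<union> {x}"] ordLeq_ordLess_trans by auto
      show ?thesis
      \<comment> \<open>The bound on hulls needs an infinite majorant. A countable segment has a
        countable hull, smaller than the uncountable \<open>A\<close>; an uncountable segment
        majorizes its own hull.\<close>
      proof (cases "countable (under r x)")
        case True
        then have "|D x| \<le>o |UNIV :: nat set|"
          unfolding D_def using C
          by (intro card_of_hull_under) (auto simp: countable_def card_of_ordLeq[symmetric])
        then have "countable (D x)"
          by (auto simp: countable_def card_of_ordLeq[symmetric])
        moreover have "\<not> |A| \<le>o |D x|"
          using False \<open>countable (D x)\<close> 
          by (metis card_of_ordLeq countable_image_inj_on countable_subset)
        ultimately show ?thesis
          using card_of_Well_order not_ordLeq_iff_ordLess by blast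
      next
        case False
        then have "|D x| \<le>o |under r x|"
          unfolding D_def using C
          by (intro card_of_hull_under) (auto simp: card_of_refl ordIso_imp_ordLeq countable_finite)
        then show ?thesis using U ordLeq_ordLess_trans by blast
      qed
    qed
    have "\<exists>w. (\<forall>a. 0 < w a \<and> w a \<le> 1) \<and>
      (\<forall>f\<in>\<F>. \<forall>\<epsilon>>0. finite {a\<in>{a\<in>A. k a = x}. \<epsilon> \<le> w a * u f a})" if "x \<in> A" for x
    proof (rule 1(1))
      have "{a\<in>A. k a = x} \<subseteq> D x" using k by auto
      then show "({a\<in>A. k a = x}, A) \<in> inv_image ordLess card_of"
        using ordLeq_ordLess_trans[OF card_of_mono1 small[OF that]] by (simp add: in_inv_image)
      show "{a\<in>A. k a = x} \<subseteq> G" using 1(2) by auto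
    qed
    then have "\<forall>x\<in>A. \<exists>w. (\<forall>a. 0 < w a \<and> w a \<le> 1) \<and>
      (\<forall>f\<in>\<F>. \<forall>\<epsilon>>0. finite {a\<in>{a\<in>A. k a = x}. \<epsilon> \<le> w a * u f a})"
      by (intro ballI)
    from bchoice[OF this] obtain w where W: "\<forall>x\<in>A. (\<forall>a. 0 < w x a \<and> w x a \<le> 1) \<and>
      (\<forall>f\<in>\<F>. \<forall>\<epsilon>>0. finite {a\<in>{a\<in>A. k a = x}. \<epsilon> \<le> w x a * u f a})" ..
    have w: "0 < w x a \<and> w x a \<le> 1" if "x \<in> A" for x a
      using bspec[OF W that] by blast
    have fin: "finite {a\<in>{a\<in>A. k a = x}. \<epsilon> \<le> w x a * u f a}" if "x \<in> A" "f \<in> \<F>" "\<epsilon> > 0" for x f \<epsilon>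
      using bspec[OF W that(1)] that(2,3) by blast
    define v where "v a = (if a \<in> A then w (k a) a else 1)" for a
    have v: "0 < v a \<and> v a \<le> 1" for a
      using w k by (auto simp: v_def)
    have "finite {a\<in>A. \<epsilon> \<le> v a * u f a}" if f: "f \<in> \<F>" and \<epsilon>: "\<epsilon> > 0" for f \<epsilon>
    proof -
      define N where "N = {a\<in>A. \<epsilon> \<le> v a * u f a}"
      have large: "\<epsilon> \<le> u f a" if "a \<in> N" for a
      proof -
        have "v a * u f a \<le> 1 * u f a"
          using v u[OF f] by (intro mult_right_mono) auto
        then show ?thesis using that by (simp add: N_def)
      qed
      have "finite (k ` N)"
      proof (rule ccontr)
        assume "infinite (k ` N)"
        moreover have "k ` N \<subseteq> Field r" using k r(3) by (auto simp: N_def)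
        \<comment> \<open>Infinitely many blocks meeting \<open>N\<close> would give a set of stages
          without a last one. The finite set that \<open>cont\<close> yields for their union
          \<open>E\<close> is caught at some stage \<open>m\<close>, yet a later block contains a
          point of \<open>N\<close> outside \<open>D m\<close>, where \<open>u f\<close> should
          already be below \<open>\<epsilon>\<close>.\<close>
        ultimately obtain T where T: "T \<subseteq> k ` N" "T \<noteq> {}"
          and nomax: "\<And>m. m \<in> T \<Longrightarrow> \<exists>x\<in>T. (x, m) \<notin> r"
          using well_order_infinite_no_max[OF r(1)] by metis
        have TA: "T \<subseteq> A" using T(1) k by (auto simp: N_def)
        have chain: "D i \<subseteq> D j \<or> D j \<subseteq> D i" if "i \<in> T" "j \<in> T" for i j
          using tot[of i j] that TA D_mono by blast
        define E where "E = (\<Union>x\<in>T. D x)"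
        have "closed_under C E"
          unfolding E_def using D_closed T(2) chain by (intro closed_under_chain_Union) auto
        moreover have "E \<subseteq> G" unfolding E_def using D_sub by blast
        ultimately obtain F where F: "finite F" "F \<subseteq> E"
          and F': "\<forall>D'. closed_under C D' \<and> F \<subseteq> D' \<and> D' \<subseteq> E \<longrightarrow> (\<forall>a\<in>E - D'. u f a < \<epsilon>)"
          using cont[OF f _ _ \<epsilon>] by meson
        obtain m where m: "m \<in> T" "F \<subseteq> D m"
          using chain_finite_subset[OF F(1) F(2)[unfolded E_def] T(2) chain] by blast
        obtain x where x: "x \<in> T" "(x, m) \<notin> r" using nomax m by blast
        obtain a where a: "a \<in> N" "x = k a" using x T by blast
        have "a \<in> D x" "a \<in> A" using a k by (auto simp: N_def)
        moreover have "a \<notin> D m"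
          using k_least[of m a] m TA x a by auto
        ultimately have "a \<in> E - D m" using x(1) by (auto simp: E_def)
        moreover have "D m \<subseteq> E" using m(1) by (auto simp: E_def)
        ultimately have "u f a < \<epsilon>"
          using F' D_closed[of m] m(2) by simp
        then show False using large[OF a(1)] by simp
      qed
      moreover have "N \<subseteq> (\<Union>x\<in>k ` N. {a\<in>{a\<in>A. k a = x}. \<epsilon> \<le> w x a * u f a})"
        by (auto simp: N_def v_def)
      moreover have "finite {a\<in>{a\<in>A. k a = x}. \<epsilon> \<le> w x a * u f a}" if "x \<in> k ` N" for x
        using that k f \<epsilon> by (intro fin) (auto simp: N_def)
      ultimately have "finite N" by (meson finite_UN_I finite_subset)
      then show ?thesis by (simp add: N_def)
    qed
    then show ?thesis using v by blast
  qed
qed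

section \<open>Neighbourhoods and Szlenk derivatives\<close>

text \<open>A basic open set of the product restricts finitely many coordinates. The map
  \<open>ev\<close> is kept general: evaluating functionals at vectors gives the weak-star topology,
  and with the roles exchanged the weak topology.\<close>

lemma pullback_fun_nbhd:
  fixes ev :: "'p \<Rightarrow> 'q \<Rightarrow> real"
  assumes "openin (pullback_topology UNIV ev euclidean) V" "p \<in> V"
  obtains I \<delta> where "finite I" "\<delta> > 0"
    "\<And>p'. (\<And>i. i \<in> I \<Longrightarrow> \<bar>ev p' i - ev p i\<bar> < \<delta>) \<Longrightarrow> p' \<in> V"
proof -
  obtain W where W: "open W" "V = ev -` W"
    using assms(1) unfolding openin_pullback_topology by auto
  then have "openin (product_topology (\<lambda>i. euclidean) UNIV) W" "ev p \<in> W"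
    using assms(2) by (auto simp: open_fun_def)
  from product_topology_open_contains_basis[OF this]
  obtain X where X: "ev p \<in> Pi\<^sub>E UNIV X" "\<And>i. open (X i)" "finite {i. X i \<noteq> UNIV}"
    "Pi\<^sub>E UNIV X \<subseteq> W" by auto
  have "\<exists>d>0. ball (ev p i) d \<subseteq> X i" for i
    using X(1,2) open_contains_ball by (metis PiE_mem UNIV_I)
  then obtain d where d: "\<And>i. d i > 0" "\<And>i. ball (ev p i) (d i) \<subseteq> X i" by metis
  define I where "I = {i. X i \<noteq> UNIV}"
  \<comment> \<open>The 1 keeps the minimum defined when \<open>I\<close> is empty.\<close>
  define \<delta> where "\<delta> = Min (insert 1 (d ` I))"
  have fin: "finite I" using X(3) by (simp add: I_def)
  show thesis
  proof (rule that[OF fin])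
    show "\<delta> > 0" using fin d(1) by (auto simp: \<delta>_def)
    fix p' assume p': "\<And>i. i \<in> I \<Longrightarrow> \<bar>ev p' i - ev p i\<bar> < \<delta>"
    have "ev p' i \<in> X i" for i
    proof (cases "i \<in> I")
      case True
      then have "\<delta> \<le> d i" using fin by (auto simp: \<delta>_def)
      then have "ev p' i \<in> ball (ev p i) (d i)"
        using p'[OF True] by (auto simp: dist_real_def)
      then show ?thesis using d(2) by blast
    qed (simp add: I_def)
    then have "ev p' \<in> Pi\<^sub>E UNIV X" by auto
    then show "p' \<in> V" using X(4) W(2) by auto
  qed
qed

text \<open>For finite \<open>F\<close> this is a basic weak-star neighbourhood with centre
  \<open>f\<close>.\<close>

definition near :: "'a set \<Rightarrow> real \<Rightarrow> ('a::real_normed_vector \<Rightarrow>\<^sub>L real) \<Rightarrow> ('a \<Rightarrow>\<^sub>L real) \<Rightarrow> bool" where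
  "near F \<delta> f g \<longleftrightarrow> (\<forall>b\<in>F. \<bar>blinfun_apply g b - blinfun_apply f b\<bar> < \<delta>)"

lemma near_mono: "near F \<delta> f g \<Longrightarrow> F' \<subseteq> F \<Longrightarrow> \<delta> \<le> \<delta>' \<Longrightarrow> near F' \<delta>' f g"
  unfolding near_def by force

text \<open>Linear combinations carry closeness from \<open>B\<close> to its span, and the common
  norm bound carries it on to the closure. Weak-star neighbourhoods in bounded sets can therefore be
  described by finite subsets of the basis.\<close>

lemma bounded_near_total:
  fixes B :: "'a::real_normed_vector set"
  assumes B: "closure (span B) = UNIV" and L: "\<And>g. g \<in> L \<Longrightarrow> norm g \<le> M" and f: "f \<in> L"
    and "\<delta> > 0"
  shows "\<exists>F \<delta>'. finite F \<and> F \<subseteq> B \<and> \<delta>' > 0 \<and> (\<forall>g\<in>L. near F \<delta>' f g \<longrightarrow> near {x} \<delta> f g)"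
proof -
  have span: "\<forall>\<delta>>0. \<exists>F \<delta>'. finite F \<and> F \<subseteq> B \<and> \<delta>' > 0 \<and> (\<forall>g\<in>L. near F \<delta>' f g \<longrightarrow> near {y} \<delta> f g)"
    if "y \<in> span B" for y
    using that
  proof (induction rule: span_induct_alt)
    case base
    show ?case by (auto simp: near_def intro!: exI[of _ "{}"] exI[of _ "1::real"])
  next
    case (step k x y)
    show ?case
    proof (intro allI impI)
      fix \<delta> :: real assume "\<delta> > 0"
      then obtain F \<delta>' where F: "finite F" "F \<subseteq> B" "\<delta>' > 0"
        "\<And>g. g \<in> L \<Longrightarrow> near F \<delta>' f g \<Longrightarrow> near {y} (\<delta>/2) f g"
        using step(2) by (metis half_gt_zero)
      \<comment> \<open>The factor \<open>\<bar>k\<bar> + 1\<close> absorbs the coefficient of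
        \<open>x\<close>, also when \<open>k\<close> is 0.\<close>
      define \<eta> where "\<eta> = min \<delta>' (\<delta> / (2 * (\<bar>k\<bar> + 1)))"
      have \<eta>: "\<eta> > 0" "\<eta> \<le> \<delta>'" using F(3) \<open>\<delta> > 0\<close> by (auto simp: \<eta>_def)
      have "near {k *\<^sub>R x + y} \<delta> f g" if g: "g \<in> L" and n: "near (insert x F) \<eta> f g" for g
      proof -
        have "near {y} (\<delta>/2) f g" using F(4)[OF g] near_mono[OF n _ \<eta>(2)] by blast
        then have 1: "\<bar>g y - f y\<bar> < \<delta>/2" by (simp add: near_def)
        have "\<bar>g x - f x\<bar> < \<delta> / (2 * (\<bar>k\<bar> + 1))" using n by (auto simp: near_def \<eta>_def)
        then have "(\<bar>k\<bar> + 1) * \<bar>g x - f x\<bar> < \<delta>/2" by (simp add: field_simps)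
        moreover have "\<bar>k * (g x - f x)\<bar> \<le> (\<bar>k\<bar> + 1) * \<bar>g x - f x\<bar>"
          unfolding abs_mult by (intro mult_right_mono) auto
        ultimately have 2: "\<bar>k * (g x - f x)\<bar> < \<delta>/2" by linarith
        have "g (k *\<^sub>R x + y) - f (k *\<^sub>R x + y) = k * (g x - f x) + (g y - f y)"
          by (simp add: blinfun.add_right blinfun.scaleR_right algebra_simps)
        then have "\<bar>g (k *\<^sub>R x + y) - f (k *\<^sub>R x + y)\<bar> < \<delta>" using 1 2 by linarith
        then show ?thesis by (simp add: near_def)
      qed
      then show "\<exists>F \<delta>'. finite F \<and> F \<subseteq> B \<and> \<delta>' > 0 \<and> (\<forall>g\<in>L. near F \<delta>' f g \<longrightarrow> near {k *\<^sub>R x + y} \<delta> f g)"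
        using F step(1) \<eta> by (intro exI[of _ "insert x F"] exI[of _ \<eta>]) auto
    qed
  qed
  have M: "M \<ge> 0" using L[OF f] norm_ge_zero order_trans by blast
  \<comment> \<open>Two members of \<open>L\<close> differ in norm by at most
    \<open>2 * (M + 1)\<close>, so moving \<open>x\<close> by this distance costs at most
    \<open>\<delta>/2\<close>.\<close>
  have "\<delta> / (4 * (M + 1)) > 0" using M \<open>\<delta> > 0\<close> by auto
  then obtain y where y: "y \<in> span B" "dist y x < \<delta> / (4 * (M + 1))"
    using B closure_approachable[of x "span B"] by auto
  obtain F \<delta>' where F: "finite F" "F \<subseteq> B" "\<delta>' > 0"
    "\<And>g. g \<in> L \<Longrightarrow> near F \<delta>' f g \<Longrightarrow> near {y} (\<delta>/2) f g"
    using span[OF y(1)] \<open>\<delta> > 0\<close> by (metis half_gt_zero)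
  have "near {x} \<delta> f g" if g: "g \<in> L" "near F \<delta>' f g" for g
  proof -
    have 1: "\<bar>g y - f y\<bar> < \<delta>/2" using F(4)[OF g] by (simp add: near_def)
    have "norm (g - f) \<le> 2 * (M + 1)"
      using norm_triangle_ineq4[of g f] L[OF g(1)] L[OF f] by simp
    then have "norm (g - f) * norm (x - y) \<le> 2 * (M + 1) * (\<delta> / (4 * (M + 1)))"
      using y(2) M by (intro mult_mono) (auto simp: dist_norm norm_minus_commute)
    also have "\<dots> = \<delta> / 2" using M by (simp add: field_simps)
    finally have 2: "\<bar>(g - f) (x - y)\<bar> \<le> \<delta> / 2"
      using norm_blinfun[of "g - f" "x - y"] by simp
    have "g x - f x = (g y - f y) + (g - f) (x - y)"
      by (simp add: blinfun.diff_left blinfun.diff_right)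
    then have "\<bar>g x - f x\<bar> < \<delta>" using 1 2 by linarith
    then show ?thesis by (simp add: near_def)
  qed
  then show ?thesis using F by blast
qed

text \<open>A pair of functionals in each neighbourhood replaces the diameter. The threshold runs
  over all \<open>\<epsilon>' < \<epsilon>\<close> because the diameter is a supremum that no pair
  need attain.\<close>

lemma szlenk_derivation_iff_near:
  fixes L :: "('a::banach \<Rightarrow>\<^sub>L real) set"
  assumes B: "closure (span B) = UNIV" and L: "\<And>g. g \<in> L \<Longrightarrow> norm g \<le> M"
  shows "f \<in> szlenk_derivation \<epsilon> L \<longleftrightarrow> f \<in> L \<and>
    (\<forall>F \<delta> \<epsilon>'. finite F \<and> F \<subseteq> B \<and> 0 < \<delta> \<and> \<epsilon>' < \<epsilon> \<longrightarrow>
      (\<exists>g\<in>L. \<exists>h\<in>L. near F \<delta> f g \<and> near F \<delta> f h \<and> \<epsilon>' < norm (g - h)))"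
    (is "_ \<longleftrightarrow> _ \<and> ?R")
proof (cases "f \<in> L")
  case True
  have "(\<exists>U. openin (subtopology weak_star_topology L) U \<and> bounded U \<and> diameter U < \<epsilon> \<and> f \<in> U) \<longleftrightarrow> \<not> ?R"
  proof
    assume "\<exists>U. openin (subtopology weak_star_topology L) U \<and> bounded U \<and> diameter U < \<epsilon> \<and> f \<in> U"
    then obtain V where V: "openin weak_star_topology V" "bounded (V \<inter> L)" "diameter (V \<inter> L) < \<epsilon>" "f \<in> V"
      by (auto simp: openin_subtopology)
    obtain I \<delta> where I: "finite I" "\<delta> > 0"
      and IV: "\<And>g. (\<And>i. i \<in> I \<Longrightarrow> \<bar>blinfun_apply g i - blinfun_apply f i\<bar> < \<delta>) \<Longrightarrow> g \<in> V"
      using pullback_fun_nbhd[OF V(1)[unfolded strong_operator_topology_def] V(4)] by metis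
    have "\<exists>F \<delta>'. finite F \<and> F \<subseteq> B \<and> \<delta>' > 0 \<and> (\<forall>g\<in>L. near F \<delta>' f g \<longrightarrow> near I \<delta> f g)"
      using I(1)
    proof induction
      case empty
      show ?case by (auto simp: near_def intro!: exI[of _ "{}"] exI[of _ "1::real"])
    next
      case (insert x I)
      then obtain F \<delta>1 where F: "finite F" "F \<subseteq> B" "\<delta>1 > 0" 
        "\<And>g. g \<in> L \<Longrightarrow> near F \<delta>1 f g \<Longrightarrow> near I \<delta> f g" by blast
      obtain G \<delta>2 where G: "finite G" "G \<subseteq> B" "\<delta>2 > 0"
        "\<And>g. g \<in> L \<Longrightarrow> near G \<delta>2 f g \<Longrightarrow> near {x} \<delta> f g"
        using bounded_near_total[OF B L True I(2), of x] by blast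
      have "near (insert x I) \<delta> f g" if g: "g \<in> L" "near (F \<union> G) (min \<delta>1 \<delta>2) f g" for g
      proof -
        have "near F \<delta>1 f g" "near G \<delta>2 f g" using g(2) by (auto simp: near_def)
        then show ?thesis using F(4) G(4) g(1) by (auto simp: near_def)
      qed
      then show ?case
        using F G by (intro exI[of _ "F \<union> G"] exI[of _ "min \<delta>1 \<delta>2"]) auto
    qed
    then obtain F \<delta>' where F: "finite F" "F \<subseteq> B" "\<delta>' > 0"
      "\<And>g. g \<in> L \<Longrightarrow> near F \<delta>' f g \<Longrightarrow> near I \<delta> f g" by blast
    have "norm (g - h) \<le> diameter (V \<inter> L)" if "g \<in> L" "h \<in> L" "near F \<delta>' f g" "near F \<delta>' f h" for g h
    proof -
      have "g \<in> V \<inter> L" "h \<in> V \<inter> L"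
        using that F(4) IV by (auto simp: near_def)
      then show ?thesis using diameter_bounded_bound[OF V(2)] by (simp add: dist_norm)
    qed
    then show "\<not> ?R" using F V(3) by (meson not_le)
  next
    assume "\<not> ?R"
    then obtain F \<delta> \<epsilon>' where F: "finite F" "0 < \<delta>" "\<epsilon>' < \<epsilon>"
      and *: "\<And>g h. g \<in> L \<Longrightarrow> h \<in> L \<Longrightarrow> near F \<delta> f g \<Longrightarrow> near F \<delta> f h \<Longrightarrow> norm (g - h) \<le> \<epsilon>'"
      by (metis not_le)
    define U where "U = {g. \<forall>b\<in>F. blinfun_apply g b \<in> ball (blinfun_apply f b) \<delta>} \<inter> L"
    have U: "g \<in> U \<longleftrightarrow> g \<in> L \<and> near F \<delta> f g" for g
      by (auto simp: U_def near_def dist_real_def abs_minus_commute)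
    have "f \<in> U" using True F(2) by (simp add: U near_def)
    moreover have "openin (subtopology weak_star_topology L) U"
      unfolding U_def openin_subtopology
      using strong_operator_topology_basis[OF F(1), of "\<lambda>b. ball (blinfun_apply f b) \<delta>" "\<lambda>b. b"] by auto
    moreover have "bounded U"
      unfolding bounded_iff using L U by blast
    moreover have "diameter U \<le> \<epsilon>'"
      using \<open>f \<in> U\<close> * U by (intro diameter_le) auto
    ultimately show "\<exists>U. openin (subtopology weak_star_topology L) U \<and> bounded U \<and> diameter U < \<epsilon> \<and> f \<in> U"
      using F(3) by (intro exI[of _ U]) auto
  qed
  then show ?thesis using True unfolding szlenk_derivation_def by blast
qed (simp add: szlenk_derivation_def)

lemma szlenk_derivation_nearD:
  fixes L :: "('a::banach \<Rightarrow>\<^sub>L real) set"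
  assumes "closure (span B) = UNIV" "\<And>g. g \<in> L \<Longrightarrow> norm g \<le> M"
    and "f \<in> szlenk_derivation \<epsilon> L" "finite F" "F \<subseteq> B" "0 < \<delta>" "\<epsilon>' < \<epsilon>"
  obtains g h where "g \<in> L" "h \<in> L" "near F \<delta> f g" "near F \<delta> f h" "\<epsilon>' < norm (g - h)"
proof -
  have "\<forall>F \<delta> \<epsilon>'. finite F \<and> F \<subseteq> B \<and> 0 < \<delta> \<and> \<epsilon>' < \<epsilon> \<longrightarrow>
      (\<exists>g\<in>L. \<exists>h\<in>L. near F \<delta> f g \<and> near F \<delta> f h \<and> \<epsilon>' < norm (g - h))"
    using szlenk_derivation_iff_near[OF assms(1,2), where f = f and \<epsilon> = \<epsilon>] assms(3) by simp
  from this[rule_format, of F \<delta> \<epsilon>'] that show thesis using assms(4-) by blast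
qed

lemma szlenk_derivation_nearI:
  fixes L :: "('a::banach \<Rightarrow>\<^sub>L real) set"
  assumes "closure (span B) = UNIV" "\<And>g. g \<in> L \<Longrightarrow> norm g \<le> M" "f \<in> L"
    and "\<And>F \<delta> \<epsilon>'. finite F \<Longrightarrow> F \<subseteq> B \<Longrightarrow> 0 < \<delta> \<Longrightarrow> \<epsilon>' < \<epsilon> \<Longrightarrow>
      \<exists>g\<in>L. \<exists>h\<in>L. near F \<delta> f g \<and> near F \<delta> f h \<and> \<epsilon>' < norm (g - h)"
  shows "f \<in> szlenk_derivation \<epsilon> L"
proof -
  have "\<forall>F \<delta> \<epsilon>'. finite F \<and> F \<subseteq> B \<and> 0 < \<delta> \<and> \<epsilon>' < \<epsilon> \<longrightarrow>
      (\<exists>g\<in>L. \<exists>h\<in>L. near F \<delta> f g \<and> near F \<delta> f h \<and> \<epsilon>' < norm (g - h))"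
    by (intro allI impI assms(4)) simp_all
  then show ?thesis
    using szlenk_derivation_iff_near[OF assms(1,2), where f = f and \<epsilon> = \<epsilon>] assms(3) by simp
qed

lemma not_szlenk_derivation_nearE:
  fixes L :: "('a::banach \<Rightarrow>\<^sub>L real) set"
  assumes "closure (span B) = UNIV" "\<And>g. g \<in> L \<Longrightarrow> norm g \<le> M"
    and "f \<in> L" "f \<notin> szlenk_derivation \<epsilon> L"
  obtains F \<delta> \<epsilon>' where "finite F" "F \<subseteq> B" "0 < \<delta>" "\<epsilon>' < \<epsilon>"
    "\<And>g h. g \<in> L \<Longrightarrow> h \<in> L \<Longrightarrow> near F \<delta> f g \<Longrightarrow> near F \<delta> f h \<Longrightarrow> norm (g - h) \<le> \<epsilon>'"
proof -
  have "\<not> (\<forall>F \<delta> \<epsilon>'. finite F \<and> F \<subseteq> B \<and> 0 < \<delta> \<and> \<epsilon>' < \<epsilon> \<longrightarrow>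
      (\<exists>g\<in>L. \<exists>h\<in>L. near F \<delta> f g \<and> near F \<delta> f h \<and> \<epsilon>' < norm (g - h)))"
    using szlenk_derivation_iff_near[OF assms(1,2), where f = f and \<epsilon> = \<epsilon>] assms(3,4) by simp
  then show thesis using that by (meson not_le)
qed

section \<open>Monotonicity of derived sets and the exit of a functional\<close>

lemma szlenk_derivation_subset: "szlenk_derivation \<epsilon> K \<subseteq> K"
  by (auto simp: szlenk_derivation_def)

text \<open>A small relatively open set of \<open>L\<close> traces a small relatively open set on
  \<open>K\<close>. This later carries the vanishing of derived sets from the unit ball to a smaller
  dual ball.\<close>

lemma szlenk_derivation_mono:
  assumes "K \<subseteq> L" shows "szlenk_derivation \<epsilon> K \<subseteq> szlenk_derivation \<epsilon> L"
proof
  fix f assume f: "f \<in> szlenk_derivation \<epsilon> K"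
  have False if U: "openin (subtopology weak_star_topology L) U" "bounded U" "diameter U < \<epsilon>" "f \<in> U" for U
  proof -
    obtain V where V: "openin weak_star_topology V" "U = V \<inter> L"
      using U(1) by (auto simp: openin_subtopology)
    have "V \<inter> K \<subseteq> U" using V assms by auto
    then have "bounded (V \<inter> K)" "diameter (V \<inter> K) \<le> diameter U"
      using U(2) bounded_subset diameter_subset by auto
    moreover have "openin (subtopology weak_star_topology K) (V \<inter> K)"
      using V(1) by (auto simp: openin_subtopology)
    moreover have "f \<in> V \<inter> K" using f U(4) V by (auto simp: szlenk_derivation_def)
    ultimately have "f \<in> \<Union>{U. openin (subtopology weak_star_topology K) U \<and> bounded U \<and> diameter U < \<epsilon>}"
      using U(3) by (intro UnionI[of "V \<inter> K"]) auto
    then show False using f by (simp add: szlenk_derivation_def)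
  qed
  then show "f \<in> szlenk_derivation \<epsilon> L"
    using f assms unfolding szlenk_derivation_def by blast
qed

text \<open>Zero, successor and limit are expressed through the order alone, since the index type is
  an arbitrary well-order.\<close>

lemma szlenk_iter_cases [case_names zero succ limit]:
  fixes \<alpha> :: "'o::wellorder"
  obtains "\<And>\<beta>. \<alpha> \<le> \<beta>" | \<beta> where "is_succ \<beta> \<alpha>" | \<beta> where "\<beta> < \<alpha>" "\<And>\<beta>. \<not> is_succ \<beta> \<alpha>"
  by (meson not_le)

lemma szlenk_iter_mono:
  fixes \<alpha> :: "'o::wellorder"
  assumes "K \<subseteq> L" shows "szlenk_iter \<epsilon> K \<alpha> \<subseteq> szlenk_iter \<epsilon> L \<alpha>"
proof (induction \<alpha> rule: less_induct)
  case (less \<alpha>)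
  show ?case
  proof (cases \<alpha> rule: szlenk_iter_cases)
    case zero
    then show ?thesis using assms by (simp add: szlenk_iter_zero)
  next
    case (succ \<beta>)
    then show ?thesis
      using less[of \<beta>] szlenk_derivation_mono by (simp add: szlenk_iter_succ is_succ_def)
  next
    case (limit \<beta>)
    then show ?thesis using less by (simp add: szlenk_iter_limit) blast
  qed
qed

lemma szlenk_iter_subset:
  fixes \<alpha> :: "'o::wellorder"
  shows "szlenk_iter \<epsilon> K \<alpha> \<subseteq> K"
proof (induction \<alpha> rule: less_induct)
  case (less \<alpha>)
  show ?case
  proof (cases \<alpha> rule: szlenk_iter_cases)
    case zero
    then show ?thesis by (simp add: szlenk_iter_zero)
  next
    case (succ \<beta>)
    then show ?thesis
      using less[of \<beta>] szlenk_derivation_subset by (force simp: szlenk_iter_succ is_succ_def)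
  next
    case (limit \<beta>)
    then show ?thesis using less by (simp add: szlenk_iter_limit) blast
  qed
qed

text \<open>The first ordinal at which \<open>f\<close> is missing is neither zero nor a limit, so
  it is a successor; \<open>\<beta>\<close> is its predecessor.\<close>

lemma szlenk_iter_exit:
  fixes \<alpha> :: "'o::wellorder"
  assumes "f \<in> K" "szlenk_iter \<epsilon> K \<alpha> = {}"
  obtains \<beta> where "\<beta> < \<alpha>" "f \<in> szlenk_iter \<epsilon> K \<beta>"
    "f \<notin> szlenk_derivation \<epsilon> (szlenk_iter \<epsilon> K \<beta>)"
proof -
  define \<gamma> where "\<gamma> = (LEAST \<gamma>. f \<notin> szlenk_iter \<epsilon> K (\<gamma> :: 'o))"
  have \<gamma>: "f \<notin> szlenk_iter \<epsilon> K \<gamma>" "\<gamma> \<le> \<alpha>"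
    using LeastI[of "\<lambda>\<gamma>. f \<notin> szlenk_iter \<epsilon> K \<gamma>" \<alpha>] Least_le[of "\<lambda>\<gamma>. f \<notin> szlenk_iter \<epsilon> K \<gamma>" \<alpha>] assms(2)
    by (auto simp: \<gamma>_def)
  have before: "f \<in> szlenk_iter \<epsilon> K \<beta>" if "\<beta> < \<gamma>" for \<beta>
    using not_less_Least that unfolding \<gamma>_def by blast
  show thesis
  proof (cases \<gamma> rule: szlenk_iter_cases)
    case zero
    then show ?thesis using \<gamma>(1) assms(1) by (simp add: szlenk_iter_zero)
  next
    case (succ \<beta>)
    then show ?thesis
      using that[of \<beta>] before[of \<beta>] \<gamma> by (auto simp: szlenk_iter_succ is_succ_def)
  next
    case (limit \<beta>)
    then show ?thesis using \<gamma>(1) before by (auto simp: szlenk_iter_limit)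
  qed
qed

section \<open>Countability of the ordinals involved\<close>

lemma countable_lessThan_omega_1:
  fixes \<alpha> :: "('a + nat set) ordinal"
  assumes "\<alpha> < omega_1"
  shows "countable {..<\<alpha>}"
proof -
  obtain r where r: "(r, r) \<in> ordIso" "\<alpha> = abs_ordinal r"
    by (cases \<alpha> rule: ordinal_cases)
  have wr: "Well_order r" using r(1) by (simp add: ordIso_def)
  \<comment> \<open>Every smaller ordinal is the type of a proper initial segment of
    \<open>r\<close>, and such a segment is determined by a point of the field.\<close>
  have "{..<\<alpha>} \<subseteq> (\<lambda>a. abs_ordinal (Restr r (underS r a))) ` Field r"
  proof
    fix \<beta> assume "\<beta> \<in> {..<\<alpha>}"
    obtain s where s: "(s, s) \<in> ordIso" "\<beta> = abs_ordinal s"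
      by (cases \<beta> rule: ordinal_cases)
    then have ws: "Well_order s" by (simp add: ordIso_def)
    have "(s, r) \<in> ordLess"
      using \<open>\<beta> \<in> {..<\<alpha>}\<close> r s by (simp add: less_ordinal.abs_eq)
    then obtain a where a: "a \<in> Field r" "(s, Restr r (underS r a)) \<in> ordIso"
      using ordLess_iff_ordIso_Restr[OF wr ws] by blast
    have "abs_ordinal s = abs_ordinal (Restr r (underS r a))"
      using a(2) by (rule Quotient3_rel_abs[OF Quotient3_ordinal])
    then show "\<beta> \<in> (\<lambda>a. abs_ordinal (Restr r (underS r a))) ` Field r" using a(1) s(2) by blast
  qed
  moreover have "countable (Field r)"
    using less_omega_1_iff[OF wr] assms r(2) by simp
  ultimately show ?thesis by (rule countable_subset[OF _ countable_image])
qed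

text \<open>The index at a single \<open>\<epsilon>\<close> is bounded by the supremum, hence it is
  an ordinal below \<open>omega_1\<close> and not \<open>Pinf\<close>.\<close>

lemma Sz_countableD:
  assumes "Sz TYPE('a::banach) < Fin omega_1" "\<epsilon> > 0"
  obtains \<alpha> :: "'a::banach szlenk_ordinal"
  where "countable {..<\<alpha>}" "szlenk_iter \<epsilon> (cball 0 1 :: ('a::banach \<Rightarrow>\<^sub>L real) set) \<alpha> = {}"
proof -
  let ?K = "cball 0 1 :: ('a \<Rightarrow>\<^sub>L real) set"
  have lt: "szlenk_index_eps ?K \<epsilon> < Fin omega_1"
    using szlenk_index_is_sup(1)[OF assms(2), of ?K] assms(1) unfolding Sz_def by simp
  then have ex: "\<exists>\<alpha> :: 'a szlenk_ordinal. szlenk_iter \<epsilon> ?K \<alpha> = {}"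
    by (auto simp: szlenk_index_eps_def split: if_splits)
  define \<alpha> :: "'a szlenk_ordinal" where "\<alpha> = (LEAST \<alpha>. szlenk_iter \<epsilon> ?K \<alpha> = {})"
  have "\<alpha> < omega_1" using lt ex by (simp add: szlenk_index_eps_def \<alpha>_def)
  moreover have "szlenk_iter \<epsilon> ?K \<alpha> = {}"
    using LeastI_ex[OF ex] by (simp add: \<alpha>_def)
  ultimately show thesis using that countable_lessThan_omega_1 by blast
qed

section \<open>Null families and dense subspaces\<close>

text \<open>The member of a cover that contains 0 contains a neighbourhood given by finitely many
  functionals, so it misses only finitely many points of \<open>Y\<close>.\<close>

lemma compactin_weak_insert_zero:
  fixes Y :: "'a::banach set"
  assumes "\<And>(f :: 'a \<Rightarrow>\<^sub>L real) \<epsilon>. \<epsilon> > 0 \<Longrightarrow> finite {y\<in>Y. \<epsilon> \<le> \<bar>f y\<bar>}"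
  shows "compactin weak_topology (insert 0 Y)"
  unfolding compactin_def
proof (intro conjI allI impI)
  show "insert 0 Y \<subseteq> topspace weak_topology"
    by (simp add: weak_topology_def topspace_pullback_topology)
  fix \<U> :: "'a set set"
  assume \<U>: "Ball \<U> (openin weak_topology) \<and> insert 0 Y \<subseteq> \<Union>\<U>"
  then obtain V where V: "V \<in> \<U>" "0 \<in> V" by auto
  then have "openin (pullback_topology UNIV (\<lambda>x (\<phi> :: 'a \<Rightarrow>\<^sub>L real). blinfun_apply \<phi> x) euclidean) V"
    using \<U> by (auto simp: weak_topology_def)
  from pullback_fun_nbhd[OF this V(2)] obtain I :: "('a \<Rightarrow>\<^sub>L real) set" and \<delta> where I: "finite I" "\<delta> > 0"
    and IV: "\<And>y. (\<And>f. f \<in> I \<Longrightarrow> \<bar>blinfun_apply f y - blinfun_apply f 0\<bar> < \<delta>) \<Longrightarrow> y \<in> V"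
    by blast
  have "Y - V \<subseteq> (\<Union>f\<in>I. {y\<in>Y. \<delta> \<le> \<bar>blinfun_apply f y\<bar>})"
    using IV by (force simp: not_less)
  then have "finite (Y - V)"
    using assms[OF I(2)] I(1) by (meson finite_UN_I finite_subset)
  moreover have "\<forall>y\<in>Y - V. \<exists>U\<in>\<U>. y \<in> U" using \<U> by blast
  then obtain U where "\<And>y. y \<in> Y - V \<Longrightarrow> U y \<in> \<U> \<and> y \<in> U y" by metis
  ultimately show "\<exists>\<F>. finite \<F> \<and> \<F> \<subseteq> \<U> \<and> insert 0 Y \<subseteq> \<Union>\<F>"
    using V by (intro exI[of _ "insert V (U ` (Y - V))"]) auto
qed

text \<open>The bound makes \<open>g\<close> Lipschitz on \<open>S\<close>, so it extends by uniform
  continuity, and linearity follows along sequences. Off \<open>S\<close> the linear map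
  \<open>g\<close> may be unbounded, as happens for maps prescribed on an algebraic basis.\<close>

lemma linear_extension_dense:
  fixes g :: "'a::real_normed_vector \<Rightarrow> 'b::banach"
  assumes g: "linear g" and S: "subspace S" "closure S = UNIV"
    and bound: "\<And>x. x \<in> S \<Longrightarrow> norm (g x) \<le> M * norm x"
  obtains P :: "'a \<Rightarrow>\<^sub>L 'b" where "\<And>x. x \<in> S \<Longrightarrow> blinfun_apply P x = g x"
proof -
  have lip: "\<bar>M\<bar>-lipschitz_on S g"
  proof (rule lipschitz_onI)
    fix x y assume "x \<in> S" "y \<in> S"
    then have "norm (g (x - y)) \<le> M * norm (x - y)" using bound S(1) subspace_diff by blast
    also have "\<dots> \<le> \<bar>M\<bar> * norm (x - y)" by (intro mult_right_mono) auto
    finally show "dist (g x) (g y) \<le> \<bar>M\<bar> * dist x y" by (simp add: dist_norm linear_diff[OF g])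
  qed simp
  obtain h where h: "uniformly_continuous_on (closure S) h" "\<And>x. x \<in> S \<Longrightarrow> g x = h x"
    using uniformly_continuous_on_extension_on_closure[OF lipschitz_on_uniformly_continuous[OF lip]] by metis
  then have cont: "isCont h x" for x
    using uniformly_continuous_imp_continuous S(2) by (metis continuous_on_eq_continuous_at open_UNIV UNIV_I)
  have lim: "(\<lambda>n. g (s n)) \<longlonglongrightarrow> h x" if "\<And>n. s n \<in> S" "s \<longlonglongrightarrow> x" for s x
    using isCont_tendsto_compose[OF cont that(2)] h(2) that(1) by simp
  have seq: "\<exists>s. (\<forall>n. s n \<in> S) \<and> s \<longlonglongrightarrow> x" for x
    using S(2) closure_sequential[of x S] by auto
  have "bounded_linear h"
  proof (rule bounded_linear_intro)
    fix x y :: 'a and r :: real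
    obtain s t where s: "\<And>n. s n \<in> S" "s \<longlonglongrightarrow> x" and t: "\<And>n. t n \<in> S" "t \<longlonglongrightarrow> y"
      using seq[of x] seq[of y] by metis
    have "(\<lambda>n. g (s n + t n)) \<longlonglongrightarrow> h (x + y)"
      using s t S(1) by (intro lim) (auto intro: subspace_add tendsto_add)
    moreover have "(\<lambda>n. g (s n + t n)) \<longlonglongrightarrow> h x + h y"
      unfolding linear_add[OF g] by (intro tendsto_add lim s t)
    ultimately show "h (x + y) = h x + h y" by (rule LIMSEQ_unique)
    have "(\<lambda>n. g (r *\<^sub>R s n)) \<longlonglongrightarrow> h (r *\<^sub>R x)"
      using s S(1) by (intro lim) (auto intro: subspace_scale tendsto_intros)
    moreover have "(\<lambda>n. g (r *\<^sub>R s n)) \<longlonglongrightarrow> r *\<^sub>R h x"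
      unfolding linear_scale[OF g] by (intro tendsto_intros lim s)
    ultimately show "h (r *\<^sub>R x) = r *\<^sub>R h x" by (rule LIMSEQ_unique)
    have "(\<lambda>n. norm (g (s n))) \<longlonglongrightarrow> norm (h x)" "(\<lambda>n. norm (s n) * M) \<longlonglongrightarrow> norm x * M"
      by (intro tendsto_intros lim s)+
    then show "norm (h x) \<le> norm x * M"
      using bound[OF s(1)] by (intro LIMSEQ_le) (auto simp: mult.commute)
  qed
  then show thesis
    using that[of "Blinfun h"] h(2) by (simp add: bounded_linear_Blinfun_apply)
qed

section \<open>Finite and countable approximation\<close>

lemma in_span_finite_subset:
  assumes "x \<in> span B" shows "\<exists>F. finite F \<and> F \<subseteq> B \<and> x \<in> span F"
proof -
  obtain t r where t: "finite t" "t \<subseteq> B" "x = (\<Sum>a\<in>t. r a *\<^sub>R a)"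
    using assms unfolding span_explicit by blast
  have "x \<in> span t"
    unfolding t(3) by (intro span_sum span_scale span_base)
  then show ?thesis using t by blast
qed

text \<open>Otherwise the closed set where \<open>\<bar>k x\<bar> \<le> \<epsilon> * norm x\<close>
  would contain the dense span, hence everything, and \<open>norm k\<close> could not exceed
  \<open>\<epsilon>\<close>.\<close>

lemma norm_blinfun_approx_span:
  fixes k :: "'a::real_normed_vector \<Rightarrow>\<^sub>L real"
  assumes B: "closure (span B) = UNIV" and "\<epsilon> < norm k"
  shows "\<exists>x\<in>span B. norm x \<le> 1 \<and> \<epsilon> < \<bar>k x\<bar>"
proof (rule ccontr)
  assume "\<not> ?thesis"
  then have le: "\<bar>k x\<bar> \<le> \<epsilon>" if "x \<in> span B" "norm x \<le> 1" for x
    using that not_less by blast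
  have "0 \<le> \<epsilon>" using le[OF span_zero] by simp
  have "span B \<subseteq> {x. \<bar>k x\<bar> \<le> \<epsilon> * norm x}"
  proof
    fix x assume x: "x \<in> span B"
    show "x \<in> {x. \<bar>k x\<bar> \<le> \<epsilon> * norm x}"
    proof (cases "x = 0")
      case False
      have "\<bar>k (inverse (norm x) *\<^sub>R x)\<bar> \<le> \<epsilon>"
        using x False by (intro le span_scale) auto
      then show ?thesis
        using False by (simp add: blinfun.scaleR_right abs_mult field_simps)
    qed (simp add: blinfun.zero_right)
  qed
  moreover have "closed {x. \<bar>k x\<bar> \<le> \<epsilon> * norm x}"
    by (intro closed_Collect_le continuous_intros)
  ultimately have "\<bar>k x\<bar> \<le> \<epsilon> * norm x" for x
    using closure_minimal B by blast
  then have "norm k \<le> \<epsilon>"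
    using \<open>0 \<le> \<epsilon>\<close> by (intro norm_blinfun_bound) auto
  then show False using assms(2) by simp
qed

text \<open>This is separability of the image of \<open>S\<close> in a finite-dimensional space: for
  each rational point and each precision one close element of \<open>S\<close> is selected, if there
  is one.\<close>

lemma countable_approximating_subset:
  fixes v :: "'s \<Rightarrow> 'i \<Rightarrow> real"
  assumes F: "finite F"
  shows "\<exists>W\<subseteq>S. countable W \<and> (\<forall>s\<in>S. \<forall>\<delta>>0. \<exists>w\<in>W. \<forall>i\<in>F. \<bar>v w i - v s i\<bar> < \<delta>)"
proof -
  define good where "good z w \<longleftrightarrow> w \<in> S \<and> (\<forall>i\<in>F. \<bar>v w i - fst z i\<bar> < inverse (real (Suc (snd z))))"
    for z :: "('i \<Rightarrow> real) \<times> nat" and w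
  define Q where "Q = (PiE F (\<lambda>_. \<rat> :: real set)) \<times> (UNIV :: nat set)"
  define W where "W = (\<lambda>z. SOME w. good z w) ` {z\<in>Q. \<exists>w. good z w}"
  have "countable Q" unfolding Q_def
    using F countable_rat by (intro countable_SIGMA countable_PiE) auto
  then have "countable W" unfolding W_def by simp
  have W: "\<exists>w\<in>W. good z w" if "z \<in> Q" "good z s" for z s
    using that someI[of "good z" s] unfolding W_def by blast
  have "W \<subseteq> S"
  proof
    fix w assume "w \<in> W"
    then obtain z where "w = (SOME w. good z w)" "\<exists>w. good z w" by (auto simp: W_def)
    then have "good z w" using someI_ex by metis
    then show "w \<in> S" by (simp add: good_def)
  qed
  moreover have "\<exists>w\<in>W. \<forall>i\<in>F. \<bar>v w i - v s i\<bar> < \<delta>" if "s \<in> S" "\<delta> > 0" for s \<delta>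
  proof -
    obtain n where n: "inverse (real (Suc n)) < \<delta> / 2"
      using reals_Archimedean[of "\<delta>/2"] \<open>\<delta> > 0\<close> by auto
    have "\<exists>q\<in>\<rat>. \<bar>v s i - q\<bar> < inverse (real (Suc n))" for i
    proof -
      obtain q where "q \<in> \<rat>" "v s i < q" "q < v s i + inverse (real (Suc n))"
        using Rats_dense_in_real[of "v s i" "v s i + inverse (real (Suc n))"] by auto
      then show ?thesis by (intro bexI[of _ q]) auto
    qed
    then obtain q where q: "\<And>i. q i \<in> \<rat>" "\<And>i. \<bar>v s i - q i\<bar> < inverse (real (Suc n))" by metis
    have "(restrict q F, n) \<in> Q" using q(1) by (auto simp: Q_def)
    moreover have "good (restrict q F, n) s" using that(1) q(2) by (auto simp: good_def)
    ultimately obtain w where w: "w \<in> W" "good (restrict q F, n) w" using W by blast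
    have "\<bar>v w i - v s i\<bar> < \<delta>" if "i \<in> F" for i
    proof -
      have "\<bar>v w i - q i\<bar> < inverse (real (Suc n))" using w(2) that by (auto simp: good_def)
      then show ?thesis using q(2)[of i] n by linarith
    qed
    then show ?thesis using w(1) by blast
  qed
  ultimately show ?thesis using \<open>countable W\<close> by blast
qed

section \<open>Bases with a norming set of countably supported functionals\<close>

locale norming_basis =
  fixes B :: "'a::banach set" and c :: real
  assumes indep: "independent B" and dense: "closure (span B) = UNIV"
    and norming: "norming c (countably_supported B id)"
begin

section \<open>The equivalent norm and its dual ball\<close>

definition unit_functionals :: "('a \<Rightarrow>\<^sub>L real) set" where
  "unit_functionals = {d. norm d \<le> 1 \<and> countable {a\<in>B. blinfun_apply d a \<noteq> 0}}"

text \<open>An equivalent norm between \<open>c * norm x\<close> and \<open>norm x\<close>, for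
  which the countably supported functionals are norming with constant 1. The constant 1 is what
  makes the later projections contractive and their adjoints self-maps of \<open>K\<close>.\<close>

definition p :: "'a \<Rightarrow> real" where
  "p x = (SUP d\<in>unit_functionals. \<bar>blinfun_apply d x\<bar>)"

definition K :: "('a \<Rightarrow>\<^sub>L real) set" where
  "K = {f. \<forall>x. \<bar>blinfun_apply f x\<bar> \<le> p x}"

lemma c_pos: "0 < c"
  using norming by (simp add: norming_def)

lemma unit_functional_le: "d \<in> unit_functionals \<Longrightarrow> \<bar>blinfun_apply d x\<bar> \<le> norm x"
  using norm_blinfun[of d x] mult_right_mono[of "norm d" 1 "norm x"]
  by (auto simp: unit_functionals_def)

lemma zero_unit_functional: "0 \<in> unit_functionals"
  by (simp add: unit_functionals_def)

lemma le_p: "d \<in> unit_functionals \<Longrightarrow> \<bar>blinfun_apply d x\<bar> \<le> p x"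
  unfolding p_def using unit_functional_le by (intro cSUP_upper bdd_aboveI2) auto

lemma p_le_norm: "p x \<le> norm x"
  unfolding p_def using unit_functional_le zero_unit_functional by (intro cSUP_least) auto

lemma norm_le_p: "c * norm x \<le> p x"
proof -
  have "{\<phi> \<in> countably_supported B id. norm \<phi> \<le> 1} = unit_functionals"
    by (auto simp: countably_supported_def unit_functionals_def)
  then show ?thesis using norming by (simp add: norming_def p_def)
qed

lemma p_approx:
  assumes "\<delta> > 0"
  shows "\<exists>d\<in>unit_functionals. p x - \<delta> < \<bar>blinfun_apply d x\<bar>"
proof -
  have "bdd_above ((\<lambda>d. \<bar>blinfun_apply d x\<bar>) ` unit_functionals)"
    using unit_functional_le by (intro bdd_aboveI2) auto
  then show ?thesis
    using less_cSUP_iff[of unit_functionals "\<lambda>d. \<bar>blinfun_apply d x\<bar>" "p x - \<delta>"] assms zero_unit_functional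
    unfolding p_def by auto
qed

lemma p_le_add: "p x \<le> p y + norm (x - y)"
  unfolding p_def[of x]
proof (rule cSUP_least)
  fix d assume d: "d \<in> unit_functionals"
  have "blinfun_apply d x = blinfun_apply d y + blinfun_apply d (x - y)"
    by (simp add: blinfun.diff_right)
  then show "\<bar>blinfun_apply d x\<bar> \<le> p y + norm (x - y)"
    using le_p[OF d, of y] unit_functional_le[OF d, of "x - y"] by linarith
qed (use zero_unit_functional in auto)

lemma K_norm: "f \<in> K \<Longrightarrow> norm f \<le> 1"
  unfolding K_def using p_le_norm by (intro norm_blinfun_bound) (auto intro: order_trans)

text \<open>Holds as \<open>p\<close> dominates \<open>c * norm\<close>; it allows arbitrary
  functionals to be scaled into \<open>K\<close>.\<close>

lemma cball_subset_K: "norm f \<le> c \<Longrightarrow> f \<in> K"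
proof -
  assume f: "norm f \<le> c"
  have "\<bar>blinfun_apply f x\<bar> \<le> p x" for x
    using norm_blinfun[of f x] mult_right_mono[OF f, of "norm x"] norm_le_p[of x] by simp
  then show ?thesis by (simp add: K_def)
qed

definition norms_span :: "'a set \<Rightarrow> 'a set \<Rightarrow> bool" where
  "norms_span A F \<longleftrightarrow> (\<forall>y\<in>span F. \<forall>\<delta>>0. \<exists>d\<in>unit_functionals.
    p y - \<delta> < \<bar>blinfun_apply d y\<bar> \<and> {a\<in>B. blinfun_apply d a \<noteq> 0} \<subseteq> A)"

text \<open>The combinations of \<open>F\<close> are approximated by countably many of them. Nearly
  norming functionals for these suffice, and the union of their supports is countable.\<close>

lemma countable_norming:
  assumes F: "finite F"
  shows "\<exists>A\<subseteq>B. countable A \<and> norms_span A F"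
proof -
  obtain W :: "('a \<Rightarrow> real) set" where W: "countable W"
    "\<And>t \<delta>. \<delta> > 0 \<Longrightarrow> \<exists>w\<in>W. \<forall>i\<in>F. \<bar>w i - t i\<bar> < \<delta>"
    using countable_approximating_subset[OF F, of UNIV "\<lambda>t :: 'a \<Rightarrow> real. t"] by auto
  have "\<exists>d\<in>unit_functionals. p y - inverse (real (Suc n)) < \<bar>blinfun_apply d y\<bar>" for y n
    by (rule p_approx) simp
  then obtain d where d: "\<And>y n. d y n \<in> unit_functionals"
    "\<And>y n. p y - inverse (real (Suc n)) < \<bar>blinfun_apply (d y n) y\<bar>" by metis
  define comb where "comb t = (\<Sum>i\<in>F. t i *\<^sub>R i)" for t :: "'a \<Rightarrow> real"
  define A where "A = (\<Union>t\<in>W. \<Union>n. {a\<in>B. blinfun_apply (d (comb t) n) a \<noteq> 0})"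
  have "countable A" unfolding A_def
    using W(1) d(1) by (intro countable_UN) (auto simp: unit_functionals_def)
  moreover have "\<exists>d\<in>unit_functionals. p y - \<delta> < \<bar>blinfun_apply d y\<bar> \<and> {a\<in>B. blinfun_apply d a \<noteq> 0} \<subseteq> A"
    if y: "y \<in> span F" and \<delta>: "\<delta> > 0" for y \<delta>
  proof -
    obtain t where t: "y = comb t"
      using y unfolding span_finite[OF F] comb_def by auto
    \<comment> \<open>With this \<open>M\<close>, where the 1 covers an empty \<open>F\<close>, the
      coefficient error below moves the combination by at most \<open>\<delta>/4\<close>.\<close>
    define M where "M = 1 + (\<Sum>i\<in>F. norm i)"
    have M: "M > 0" unfolding M_def by (intro add_pos_nonneg sum_nonneg) auto
    obtain w where w: "w \<in> W" "\<And>i. i \<in> F \<Longrightarrow> \<bar>w i - t i\<bar> < \<delta> / (4 * M)"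
      using W(2)[of "\<delta> / (4 * M)" t] \<delta> M by auto
    have "norm (comb w - y) = norm (\<Sum>i\<in>F. (w i - t i) *\<^sub>R i)"
      unfolding t comb_def by (simp add: sum_subtractf scaleR_left_diff_distrib)
    also have "\<dots> \<le> (\<Sum>i\<in>F. \<delta> / (4 * M) * norm i)"
      using less_imp_le[OF w(2)]
      by (intro sum_norm_le) (simp only: norm_scaleR real_norm_def, intro mult_right_mono, auto)
    also have "\<dots> = \<delta> / (4 * M) * (\<Sum>i\<in>F. norm i)" by (simp add: sum_distrib_left)
    also have "\<dots> \<le> \<delta> / (4 * M) * M"
      using \<delta> M by (intro mult_left_mono) (auto simp: M_def)
    finally have close: "norm (comb w - y) \<le> \<delta> / 4" using M by simp
    obtain n where n: "inverse (real (Suc n)) < \<delta> / 4"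
      using reals_Archimedean[of "\<delta>/4"] \<delta> by auto
    let ?d = "d (comb w) n"
    \<comment> \<open>Three losses of at most \<open>\<delta>/4\<close> each: moving
      \<open>p\<close> to \<open>comb w\<close>, using \<open>?d\<close> there in place of
      \<open>p\<close>, and moving \<open>?d\<close> back to \<open>y\<close>.\<close>
    have "p y \<le> p (comb w) + \<delta> / 4"
      using p_le_add[of y "comb w"] close by (simp add: norm_minus_commute)
    moreover have "p (comb w) < \<bar>blinfun_apply ?d (comb w)\<bar> + \<delta> / 4"
      using d(2)[of "comb w" n] n by linarith
    moreover have "\<bar>blinfun_apply ?d (comb w - y)\<bar> \<le> \<delta> / 4"
      using unit_functional_le[OF d(1)] close order_trans by blast
    moreover have "blinfun_apply ?d (comb w) = blinfun_apply ?d y + blinfun_apply ?d (comb w - y)"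
      by (simp add: blinfun.diff_right)
    ultimately have "p y - \<delta> < \<bar>blinfun_apply ?d y\<bar>" using \<delta> by linarith
    moreover have "{a\<in>B. blinfun_apply ?d a \<noteq> 0} \<subseteq> A" using w(1) by (auto simp: A_def)
    ultimately show ?thesis using d(1) by blast
  qed
  moreover have "A \<subseteq> B" by (auto simp: A_def)
  ultimately show ?thesis unfolding norms_span_def by blast
qed

end

section \<open>Countable witness sets for the derivatives of \<open>K\<close>\<close>

locale szlenk_norming_basis = norming_basis B c for B :: "'a::banach set" and c +
  fixes ht :: "nat \<Rightarrow> 'o::wellorder"
  assumes countable_ht: "countable {..<ht m}"
    and szlenk_ht: "szlenk_iter (inverse (real (Suc m))) (cball 0 1 :: ('a \<Rightarrow>\<^sub>L real) set) (ht m) = {}"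
begin

definition S :: "nat \<Rightarrow> 'o \<Rightarrow> ('a \<Rightarrow>\<^sub>L real) set" where
  "S m \<alpha> = szlenk_iter (inverse (real (Suc m))) K \<alpha>"

lemma S_subset: "S m \<alpha> \<subseteq> K"
  unfolding S_def by (rule szlenk_iter_subset)

lemma S_norm: "f \<in> S m \<alpha> \<Longrightarrow> norm f \<le> 1"
  using S_subset K_norm by blast

lemma S_ht: "S m (ht m) = {}"
  using szlenk_iter_mono[of K "cball 0 1" "inverse (real (Suc m))" "ht m"] szlenk_ht K_norm
  unfolding S_def by (force simp: subset_iff)

text \<open>The distance of \<open>g\<close> and \<open>h\<close> has to be visible on
  \<open>span A\<close>, so that it survives composition with any projection that fixes
  \<open>span A\<close>.\<close>

definition separates_derivatives :: "'a set \<Rightarrow> 'a set \<Rightarrow> bool" where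
  "separates_derivatives A F \<longleftrightarrow> (\<forall>m. \<forall>\<alpha><ht m. \<forall>f\<in>szlenk_derivation (inverse (real (Suc m))) (S m \<alpha>).
    \<forall>\<delta>>0. \<forall>\<epsilon><inverse (real (Suc m)). \<exists>g\<in>S m \<alpha>. \<exists>h\<in>S m \<alpha>. near F \<delta> f g \<and> near F \<delta> f h \<and>
      (\<exists>x\<in>span A. norm x \<le> 1 \<and> \<epsilon> < \<bar>blinfun_apply (g - h) x\<bar>))"

text \<open>Countably many triples of \<open>m\<close>, \<open>\<alpha> < ht m\<close> and a
  rational threshold have to be served; here the countable Szlenk index enters. For each triple,
  countably many pairs imitate all admissible pairs on \<open>F\<close>, and each pair needs
  finitely many basis vectors to exhibit its distance.\<close>

lemma countable_witnesses:
  assumes F: "finite F" "F \<subseteq> B"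
  shows "\<exists>A\<subseteq>B. countable A \<and> separates_derivatives A F"
proof -
  define wit where "wit k \<epsilon> G \<longleftrightarrow> finite G \<and> G \<subseteq> B \<and>
    (\<epsilon> < norm k \<longrightarrow> (\<exists>x\<in>span G. norm x \<le> 1 \<and> \<epsilon> < \<bar>blinfun_apply k x\<bar>))"
    for k :: "'a \<Rightarrow>\<^sub>L real" and \<epsilon> G
  have "\<exists>G. wit k \<epsilon> G" for k \<epsilon>
  proof (cases "\<epsilon> < norm k")
    case True
    then obtain x where "x \<in> span B" "norm x \<le> 1" "\<epsilon> < \<bar>blinfun_apply k x\<bar>"
      using norm_blinfun_approx_span[OF dense] by blast
    then show ?thesis using in_span_finite_subset[of x B] unfolding wit_def by blast
  qed (auto simp: wit_def intro!: exI[of _ "{}"])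
  then obtain G where "\<And>k \<epsilon>. wit k \<epsilon> (G k \<epsilon>)" by metis
  then have G: "finite (G k \<epsilon>)" "G k \<epsilon> \<subseteq> B"
    "\<epsilon> < norm k \<Longrightarrow> \<exists>x\<in>span (G k \<epsilon>). norm x \<le> 1 \<and> \<epsilon> < \<bar>blinfun_apply k x\<bar>" for k \<epsilon>
    unfolding wit_def by blast+
  define pairs where "pairs m \<alpha> \<epsilon> = {(g, h). g \<in> S m \<alpha> \<and> h \<in> S m \<alpha> \<and> \<epsilon> < norm (g - h)}" for m \<alpha> \<epsilon>
  \<comment> \<open>A pair of functionals is read as one function on vectors and booleans, so that
    both components are approximated at once.\<close>
  let ?v = "(\<lambda>gh is. blinfun_apply (if snd is then fst gh else snd gh) (fst is))
    :: ('a \<Rightarrow>\<^sub>L real) \<times> ('a \<Rightarrow>\<^sub>L real) \<Rightarrow> 'a \<times> bool \<Rightarrow> real"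
  have "finite (F \<times> (UNIV :: bool set))" using F(1) by simp
  note approx = countable_approximating_subset[OF this, where v = ?v]
  define good where "good P W \<longleftrightarrow> W \<subseteq> P \<and> countable W \<and>
    (\<forall>s\<in>P. \<forall>\<delta>>0. \<exists>w\<in>W. \<forall>i\<in>F \<times> UNIV. \<bar>?v w i - ?v s i\<bar> < \<delta>)" for P W
  have "\<exists>W. good P W" for P
    using approx[of P] unfolding good_def by blast
  then obtain V where "\<And>P. good P (V P)" by metis
  then have good: "good (pairs m \<alpha> \<epsilon>) (V (pairs m \<alpha> \<epsilon>))" for m \<alpha> \<epsilon> by blast
  define W where "W m \<alpha> \<epsilon> = V (pairs m \<alpha> \<epsilon>)" for m \<alpha> \<epsilon>
  have W: "W m \<alpha> \<epsilon> \<subseteq> pairs m \<alpha> \<epsilon>" "countable (W m \<alpha> \<epsilon>)"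
    "s \<in> pairs m \<alpha> \<epsilon> \<Longrightarrow> \<delta> > 0 \<Longrightarrow> \<exists>w\<in>W m \<alpha> \<epsilon>. \<forall>i\<in>F \<times> UNIV. \<bar>?v w i - ?v s i\<bar> < \<delta>"
    for m \<alpha> \<epsilon> s \<delta>
    using good[of m \<alpha> \<epsilon>] unfolding good_def W_def by blast+
  define A where "A = (\<Union>m. \<Union>\<alpha>\<in>{..<ht m}. \<Union>\<epsilon>\<in>\<rat>. \<Union>w\<in>W m \<alpha> \<epsilon>. G (fst w - snd w) \<epsilon>)"
  have cA: "countable A" unfolding A_def
    using countable_ht countable_rat W(2) G(1)
    by (intro countable_UN) (auto intro: countable_finite)
  have AB: "A \<subseteq> B" unfolding A_def using G(2) by blast
  have wit: "\<exists>g\<in>S m \<alpha>. \<exists>h\<in>S m \<alpha>. near F \<delta> f g \<and> near F \<delta> f h \<and>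
      (\<exists>x\<in>span A. norm x \<le> 1 \<and> \<epsilon> < \<bar>blinfun_apply (g - h) x\<bar>)"
    if \<alpha>: "\<alpha> < ht m" and f: "f \<in> szlenk_derivation (inverse (real (Suc m))) (S m \<alpha>)"
      and \<delta>: "\<delta> > 0" and \<epsilon>: "\<epsilon> < inverse (real (Suc m))" for m \<alpha> f \<delta> \<epsilon>
  proof -
    \<comment> \<open>\<open>A\<close> collects vectors for rational thresholds only, so
      \<open>\<epsilon>\<close> is first raised to a rational one.\<close>
    obtain q where q: "q \<in> \<rat>" "\<epsilon> < q" "q < inverse (real (Suc m))"
      using Rats_dense_in_real[OF \<epsilon>] by blast
    obtain g h where gh: "g \<in> S m \<alpha>" "h \<in> S m \<alpha>" "near F (\<delta>/2) f g" "near F (\<delta>/2) f h" "q < norm (g - h)"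
      by (rule szlenk_derivation_nearD[OF dense S_norm f F half_gt_zero[OF \<delta>] q(3)])
    then have "(g, h) \<in> pairs m \<alpha> q" by (simp add: pairs_def)
    then obtain w where w: "w \<in> W m \<alpha> q" "\<And>i. i \<in> F \<times> UNIV \<Longrightarrow> \<bar>?v w i - ?v (g, h) i\<bar> < \<delta>/2"
      using W(3)[of "(g, h)" m \<alpha> q "\<delta>/2"] \<delta> by auto
    obtain g' h' where w': "w = (g', h')" by (cases w)
    have gh': "g' \<in> S m \<alpha>" "h' \<in> S m \<alpha>" "q < norm (g' - h')"
      using W(1) w(1) by (auto simp: w' pairs_def)
    have "\<bar>blinfun_apply g' i - blinfun_apply g i\<bar> < \<delta>/2"
      "\<bar>blinfun_apply h' i - blinfun_apply h i\<bar> < \<delta>/2" if "i \<in> F" for i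
      using w(2)[of "(i, True)"] w(2)[of "(i, False)"] that by (auto simp: w')
    then have "near F \<delta> f g'" "near F \<delta> f h'"
      using gh(3,4) unfolding near_def by (smt (verit) field_sum_of_halves)+
    moreover obtain x where "x \<in> span (G (g' - h') q)" "norm x \<le> 1" "q < \<bar>blinfun_apply (g' - h') x\<bar>"
      using G(3)[OF gh'(3)] by blast
    moreover have "G (g' - h') q \<subseteq> A"
      unfolding A_def using \<alpha> q(1) w(1) by (force simp: w')
    ultimately show ?thesis
      using gh'(1,2) q(2) span_mono[of "G (g' - h') q" A] by (meson less_trans subsetD)
  qed
  have "separates_derivatives A F"
    unfolding separates_derivatives_def by (intro allI impI ballI) (rule wit)
  then show ?thesis using cA AB by blast
qed

lemma norms_span_mono: "norms_span A F \<Longrightarrow> A \<subseteq> A' \<Longrightarrow> norms_span A' F"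
  unfolding norms_span_def by (meson subset_trans)

lemma separates_derivatives_mono:
  assumes "separates_derivatives A F" "A \<subseteq> A'"
  shows "separates_derivatives A' F"
  using assms(1) span_mono[OF assms(2)] unfolding separates_derivatives_def by (meson subsetD)

text \<open>The guard lets \<open>{}\<close> serve for all other arguments, so that \<open>C\<close>
  is total with countable values inside \<open>B\<close>.\<close>

definition C_spec :: "'a set \<Rightarrow> 'a set \<Rightarrow> bool" where
  "C_spec F A \<longleftrightarrow> A \<subseteq> B \<and> countable A \<and>
    (finite F \<and> F \<subseteq> B \<longrightarrow> norms_span A F \<and> separates_derivatives A F)"

definition C :: "'a set \<Rightarrow> 'a set" where
  "C F = (SOME A. C_spec F A)"

lemma C_spec: "C_spec F (C F)"
proof -
  have "\<exists>A. C_spec F A"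
  proof (cases "finite F \<and> F \<subseteq> B")
    case True
    obtain A1 where A1: "A1 \<subseteq> B" "countable A1" "norms_span A1 F"
      using countable_norming[OF conjunct1[OF True]] by blast
    obtain A2 where A2: "A2 \<subseteq> B" "countable A2" "separates_derivatives A2 F"
      using countable_witnesses[OF conjunct1[OF True] conjunct2[OF True]] by blast
    have "C_spec F (A1 \<union> A2)"
      using A1 A2 norms_span_mono[OF A1(3)] separates_derivatives_mono[OF A2(3)]
      by (simp add: C_spec_def)
    then show ?thesis ..
  next
    case False
    then show ?thesis by (intro exI[of _ "{}"]) (auto simp: C_spec_def)
  qed
  then show ?thesis unfolding C_def by (rule someI_ex[of "C_spec F"])
qed

lemma countable_C: "countable (C F)" and C_subset: "C F \<subseteq> B"
  using C_spec[of F] by (auto simp: C_spec_def)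

lemma C_norming:
  assumes "finite F" "F \<subseteq> B" "y \<in> span F" "\<delta> > 0"
  shows "\<exists>d\<in>unit_functionals. p y - \<delta> < \<bar>blinfun_apply d y\<bar> \<and> {a\<in>B. blinfun_apply d a \<noteq> 0} \<subseteq> C F"
  using C_spec[of F] assms by (simp add: C_spec_def norms_span_def)

lemma C_witnesses:
  assumes "finite F" "F \<subseteq> B" "\<alpha> < ht m" "f \<in> szlenk_derivation (inverse (real (Suc m))) (S m \<alpha>)"
    "\<delta> > 0" "\<epsilon> < inverse (real (Suc m))"
  obtains g h x where "g \<in> S m \<alpha>" "h \<in> S m \<alpha>" "near F \<delta> f g" "near F \<delta> f h"
    "x \<in> span (C F)" "norm x \<le> 1" "\<epsilon> < \<bar>blinfun_apply (g - h) x\<bar>"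
proof -
  have "separates_derivatives (C F) F"
    using C_spec[of F] assms(1,2) by (simp add: C_spec_def)
  from this[unfolded separates_derivatives_def, rule_format, OF assms(3-6)]
  show thesis using that by blast
qed

section \<open>Projections onto the spans of \<open>C\<close>-closed sets\<close>

lemma ex_projection:
  assumes D: "closed_under C D" "D \<subseteq> B"
  shows "\<exists>P :: 'a \<Rightarrow>\<^sub>L 'a. (\<forall>a\<in>B. blinfun_apply P a = (if a \<in> D then a else 0)) \<and>
    (\<forall>x. p (blinfun_apply P x) \<le> p x)"
proof -
  obtain g :: "'a \<Rightarrow> 'a" where g: "linear g" "\<And>a. a \<in> B \<Longrightarrow> g a = (if a \<in> D then a else 0)"
    using linear_independent_extend[OF indep, of "\<lambda>a. if a \<in> D then a else 0"] by blast
  have pg: "p (g x) \<le> p x" if x: "x \<in> span B" for x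
  proof (rule field_le_epsilon)
    fix \<delta> :: real assume \<delta>: "\<delta> > 0"
    obtain F r where F: "finite F" "F \<subseteq> B" "x = (\<Sum>a\<in>F. r a *\<^sub>R a)"
      using x unfolding span_explicit by blast
    have "g x = (\<Sum>a\<in>F. r a *\<^sub>R g a)"
      unfolding F(3) by (simp add: linear_sum[OF g(1)] linear_scale[OF g(1)])
    also have "\<dots> = (\<Sum>a\<in>F. if a \<in> D then r a *\<^sub>R a else 0)"
      using F(2) g(2) by (intro sum.cong) auto
    also have "\<dots> = (\<Sum>a\<in>F \<inter> D. r a *\<^sub>R a)"
      using F(1) by (simp add: sum.inter_restrict)
    finally have gx: "g x = (\<Sum>a\<in>F \<inter> D. r a *\<^sub>R a)" .
    have "g x \<in> span (F \<inter> D)"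
      unfolding gx by (intro span_sum span_scale span_base)
    \<comment> \<open>The reason for contractivity: on \<open>B\<close> the functional
      \<open>d\<close> is supported in \<open>C (F \<inter> D)\<close>, hence in \<open>D\<close>.
      It therefore ignores \<open>x - g x\<close>, and its value at \<open>g x\<close>, which is
      nearly \<open>p (g x)\<close>, equals its value at \<open>x\<close>, at most
      \<open>p x\<close>.\<close>
    then obtain d where d: "d \<in> unit_functionals" "p (g x) - \<delta> < \<bar>blinfun_apply d (g x)\<bar>"
      "{a\<in>B. blinfun_apply d a \<noteq> 0} \<subseteq> C (F \<inter> D)"
      using C_norming[of "F \<inter> D" "g x" \<delta>] F \<delta> by blast
    have "C (F \<inter> D) \<subseteq> D" using closed_underD[OF D(1), of "F \<inter> D"] F(1) by auto
    then have "blinfun_apply d a = 0" if "a \<in> F - D" for a using d(3) F(2) that by blast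
    moreover have "blinfun_apply d x = blinfun_apply d (g x) + (\<Sum>a\<in>F - D. r a * blinfun_apply d a)"
    proof -
      have "blinfun_apply d (g x) = (\<Sum>a\<in>F \<inter> D. r a * blinfun_apply d a)"
        by (simp only: gx blinfun.sum_right blinfun.scaleR_right real_scaleR_def)
      moreover have "blinfun_apply d x = (\<Sum>a\<in>F. r a * blinfun_apply d a)"
        by (simp only: F(3) blinfun.sum_right blinfun.scaleR_right real_scaleR_def)
      ultimately show ?thesis
        using sum.Int_Diff[OF F(1), of "\<lambda>a. r a * blinfun_apply d a" D] by simp
    qed
    ultimately have "blinfun_apply d x = blinfun_apply d (g x)" by simp
    then show "p (g x) \<le> p x + \<delta>" using d(2) le_p[OF d(1), of x] by simp
  qed
  \<comment> \<open>Equivalence of \<open>p\<close> and the norm provides the bound that the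
    extension from the dense span requires.\<close>
  have "norm (g x) \<le> inverse c * norm x" if "x \<in> span B" for x
  proof -
    have "c * norm (g x) \<le> norm x"
      using pg[OF that] norm_le_p[of "g x"] p_le_norm[of x] by linarith
    then show ?thesis using c_pos by (simp add: field_simps)
  qed
  then obtain P :: "'a \<Rightarrow>\<^sub>L 'a" where P: "\<And>x. x \<in> span B \<Longrightarrow> blinfun_apply P x = g x"
    using linear_extension_dense[OF g(1) subspace_span dense] by metis
  have "p (blinfun_apply P x) \<le> p x" for x
  proof (rule field_le_epsilon)
    fix \<delta> :: real assume \<delta>: "\<delta> > 0"
    \<comment> \<open>Replacing \<open>x\<close> by \<open>y\<close> costs \<open>norm P\<close>
      times their distance on the image side and once their distance for \<open>p\<close>
      itself.\<close>
    have "\<delta> / (1 + norm P) > 0" using \<delta> by (simp add: add_pos_nonneg)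
    then obtain y where y: "y \<in> span B" "dist y x < \<delta> / (1 + norm P)"
      using dense closure_approachable[of x "span B"] by auto
    have "p (blinfun_apply P x) \<le> p (blinfun_apply P y) + norm (blinfun_apply P (x - y))"
      using p_le_add[of "blinfun_apply P x" "blinfun_apply P y"] by (simp add: blinfun.diff_right)
    also have "\<dots> \<le> p y + norm P * norm (x - y)"
      using pg[OF y(1)] P[OF y(1)] norm_blinfun[of P "x - y"] by simp
    also have "\<dots> \<le> p x + (1 + norm P) * norm (x - y)"
      using p_le_add[of y x] by (simp add: algebra_simps norm_minus_commute)
    also have "\<dots> \<le> p x + (1 + norm P) * (\<delta> / (1 + norm P))"
      using y(2) by (intro add_left_mono mult_left_mono) (auto simp: dist_norm norm_minus_commute)
    also have "\<dots> = p x + \<delta>"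
    proof -
      have "1 + norm P \<noteq> 0" using norm_ge_zero[of P] by linarith
      then show ?thesis by simp
    qed
    finally show "p (blinfun_apply P x) \<le> p x + \<delta>" .
  qed
  then show ?thesis using P g(2) span_base by (metis)
qed

definition proj :: "'a set \<Rightarrow> 'a \<Rightarrow>\<^sub>L 'a" where
  "proj D = (SOME P. (\<forall>a\<in>B. blinfun_apply P a = (if a \<in> D then a else 0)) \<and>
    (\<forall>x. p (blinfun_apply P x) \<le> p x))"

context
  fixes D assumes D: "closed_under C D" "D \<subseteq> B"
begin

lemma proj_basis: "a \<in> B \<Longrightarrow> blinfun_apply (proj D) a = (if a \<in> D then a else 0)"
  and p_proj: "p (blinfun_apply (proj D) x) \<le> p x"
  using someI_ex[OF ex_projection[OF D]] unfolding proj_def by blast+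

lemma proj_span: "x \<in> span D \<Longrightarrow> blinfun_apply (proj D) x = x"
proof (induction rule: span_induct_alt)
  case (step r a y)
  then have "blinfun_apply (proj D) a = a" using proj_basis D(2) by auto
  then show ?case using step by (simp add: blinfun.add_right blinfun.scaleR_right)
qed simp

lemma compose_proj_K: "f \<in> K \<Longrightarrow> f o\<^sub>L proj D \<in> K"
  using p_proj order_trans by (fastforce simp: K_def)

text \<open>At a successor, witnesses \<open>g\<close> and \<open>h\<close> close to
  \<open>f\<close> on \<open>F \<inter> D\<close> are composed with the projection. They stay close
  to the composed \<open>f\<close>, since all three vanish on \<open>F - D\<close>, and they stay
  apart, since their distance is seen at a vector of \<open>span D\<close>, which the projection
  fixes. The bound on \<open>\<alpha>\<close> is there because witnesses exist only for stages below
  \<open>ht m\<close>.\<close>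

lemma compose_proj_S: "\<alpha> \<le> ht m \<Longrightarrow> f \<in> S m \<alpha> \<Longrightarrow> f o\<^sub>L proj D \<in> S m \<alpha>"
proof (induction \<alpha> arbitrary: f rule: less_induct)
  case (less \<alpha>)
  show ?case
  proof (cases \<alpha> rule: szlenk_iter_cases)
    case zero
    then show ?thesis using less.prems compose_proj_K by (simp add: S_def szlenk_iter_zero)
  next
    case (succ \<beta>)
    let ?\<epsilon> = "inverse (real (Suc m))"
    have \<beta>: "\<beta> < \<alpha>" "\<beta> < ht m" using succ less.prems(1) by (auto simp: is_succ_def)
    have S\<alpha>: "S m \<alpha> = szlenk_derivation ?\<epsilon> (S m \<beta>)"
      using succ by (simp add: S_def szlenk_iter_succ)
    have inv: "g o\<^sub>L proj D \<in> S m \<beta>" if "g \<in> S m \<beta>" for g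
      using less.IH[OF \<beta>(1)] \<beta>(2) that by simp
    have f: "f \<in> szlenk_derivation ?\<epsilon> (S m \<beta>)" using less.prems S\<alpha> by simp
    then have "f \<in> S m \<beta>" using szlenk_derivation_subset by blast
    have wit: "\<exists>g\<in>S m \<beta>. \<exists>h\<in>S m \<beta>. near F \<delta> (f o\<^sub>L proj D) g \<and> near F \<delta> (f o\<^sub>L proj D) h \<and> \<epsilon>' < norm (g - h)"
      if F: "finite F" "F \<subseteq> B" and \<delta>: "\<delta> > 0" and \<epsilon>': "\<epsilon>' < ?\<epsilon>" for F \<delta> \<epsilon>'
    proof -
      obtain g h x where gh: "g \<in> S m \<beta>" "h \<in> S m \<beta>" "near (F \<inter> D) \<delta> f g" "near (F \<inter> D) \<delta> f h"
        and x: "x \<in> span (C (F \<inter> D))" "norm x \<le> 1" "\<epsilon>' < \<bar>blinfun_apply (g - h) x\<bar>"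
        using C_witnesses[of "F \<inter> D" \<beta> m f \<delta> \<epsilon>'] F \<beta>(2) f \<delta> \<epsilon>' by blast
      have near: "near F \<delta> (f o\<^sub>L proj D) (k o\<^sub>L proj D)" if "near (F \<inter> D) \<delta> f k" for k
        using that F(2) \<delta> proj_basis by (auto simp: near_def subset_iff)
      have "C (F \<inter> D) \<subseteq> D" using closed_underD[OF D(1), of "F \<inter> D"] F(1) by auto
      then have "blinfun_apply (proj D) x = x" using x(1) span_mono proj_span by blast
      then have eq: "blinfun_apply (g - h) x = blinfun_apply ((g o\<^sub>L proj D) - (h o\<^sub>L proj D)) x"
        by (simp add: blinfun.diff_left)
      have "\<bar>blinfun_apply (g - h) x\<bar> \<le> norm ((g o\<^sub>L proj D) - (h o\<^sub>L proj D))"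
        unfolding eq using norm_blinfun[of "(g o\<^sub>L proj D) - (h o\<^sub>L proj D)" x]
          mult_left_mono[OF x(2), of "norm ((g o\<^sub>L proj D) - (h o\<^sub>L proj D))"] by simp
      then have "\<epsilon>' < norm ((g o\<^sub>L proj D) - (h o\<^sub>L proj D))" using x(3) by simp
      then show ?thesis using inv gh near by blast
    qed
    show ?thesis
      unfolding S\<alpha> by (intro szlenk_derivation_nearI[OF dense S_norm inv[OF \<open>f \<in> S m \<beta>\<close>]] wit)
  next
    case (limit \<beta>)
    then show ?thesis
      using less.IH less.prems by (auto simp: S_def szlenk_iter_limit)
  qed
qed

end

section \<open>Norm continuity of restrictions\<close>

text \<open>
  The nets of restrictions \<open>f \<circ> proj D\<close> converge in norm: a relatively weak-star open set of small
  diameter around \<open>f \<circ> proj D\<close> in a Szlenk derivative of \<open>K\<close> is determined by finitely many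
  elements of \<open>B\<close>, and the derivative is invariant under the projections.
\<close>

lemma compose_proj_continuous:
  assumes f: "f \<in> K" and D: "closed_under C D" "D \<subseteq> B" and \<epsilon>: "\<epsilon> > 0"
  shows "\<exists>F. finite F \<and> F \<subseteq> D \<and> (\<forall>D'. closed_under C D' \<and> F \<subseteq> D' \<and> D' \<subseteq> D \<longrightarrow>
    (\<forall>a\<in>D - D'. \<bar>blinfun_apply f a\<bar> / norm a < \<epsilon>))"
proof -
  obtain m where m: "inverse (real (Suc m)) < \<epsilon>" using reals_Archimedean[OF \<epsilon>] by blast
  let ?\<epsilon> = "inverse (real (Suc m))"
  define g where "g = f o\<^sub>L proj D"
  have "g \<in> K" using compose_proj_K[OF D f] by (simp add: g_def)
  then obtain \<beta> where \<beta>: "\<beta> < ht m" "g \<in> S m \<beta>" "g \<notin> szlenk_derivation ?\<epsilon> (S m \<beta>)"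
    using szlenk_iter_exit[OF _ S_ht[unfolded S_def]] unfolding S_def by metis
  obtain F \<delta> \<epsilon>' where F: "finite F" "F \<subseteq> B" "\<delta> > 0" "\<epsilon>' < ?\<epsilon>"
    and small: "\<And>h k. h \<in> S m \<beta> \<Longrightarrow> k \<in> S m \<beta> \<Longrightarrow> near F \<delta> g h \<Longrightarrow> near F \<delta> g k \<Longrightarrow> norm (h - k) \<le> \<epsilon>'"
    by (rule not_szlenk_derivation_nearE[OF dense _ \<beta>(2,3)]) (erule S_norm, rule that)
  \<comment> \<open>Only \<open>F \<inter> D\<close> can be required to lie in \<open>D'\<close>. On
    the rest of \<open>F\<close> both \<open>g\<close> and its composition with
    \<open>proj D'\<close> vanish.\<close>
  have "\<bar>blinfun_apply f a\<bar> / norm a < \<epsilon>"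
    if D': "closed_under C D'" "F \<inter> D \<subseteq> D'" "D' \<subseteq> D" and a: "a \<in> D - D'" for D' a
  proof -
    have D'B: "D' \<subseteq> B" using D' D(2) by blast
    have "g o\<^sub>L proj D' \<in> S m \<beta>" using compose_proj_S[OF D'(1) D'B] \<beta> by simp
    moreover have "near F \<delta> g (g o\<^sub>L proj D')"
      using F(2,3) D'(2,3) proj_basis[OF D'(1) D'B] proj_basis[OF D]
      by (auto simp: near_def g_def subset_iff)
    moreover have "near F \<delta> g g" using F(3) by (simp add: near_def)
    ultimately have "norm (g - (g o\<^sub>L proj D')) \<le> \<epsilon>'" using small \<beta>(2) by blast
    then have lt: "norm (g - (g o\<^sub>L proj D')) < \<epsilon>" using F(4) m by simp
    have "a \<in> B" using a D(2) by blast
    \<comment> \<open>At \<open>a\<close>, which lies in \<open>D - D'\<close>, the functional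
      \<open>g\<close> agrees with \<open>f\<close> and the composed one vanishes.\<close>
    then have "blinfun_apply (g - (g o\<^sub>L proj D')) a = blinfun_apply f a"
      using a proj_basis[OF D'(1) D'B] proj_basis[OF D] by (simp add: g_def blinfun.diff_left)
    then have "\<bar>blinfun_apply f a\<bar> \<le> norm (g - (g o\<^sub>L proj D')) * norm a"
      using norm_blinfun[of "g - (g o\<^sub>L proj D')" a] by simp
    moreover have "norm a > 0" using \<open>a \<in> B\<close> indep dependent_zero by auto
    ultimately have "\<bar>blinfun_apply f a\<bar> / norm a \<le> norm (g - (g o\<^sub>L proj D'))"
      by (simp add: pos_divide_le_eq)
    then show ?thesis using lt by simp
  qed
  then show ?thesis using F(1) by (intro exI[of _ "F \<inter> D"]) blast
qed

section \<open>Weak compactness of the weighted basis\<close>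

lemma weakly_compactly_generated: "weakly_compactly_generated TYPE('a)"
proof -
  have u: "0 \<le> \<bar>blinfun_apply f a\<bar> / norm a \<and> \<bar>blinfun_apply f a\<bar> / norm a \<le> 1" if "f \<in> K" for f a
  proof -
    have "\<bar>blinfun_apply f a\<bar> \<le> norm a" using that p_le_norm[of a] by (simp add: K_def order_trans[OF _ p_le_norm])
    then show ?thesis by (auto simp: divide_le_eq_1)
  qed
  have "closed_under C B" using C_subset by (simp add: closed_under_def)
  then have "\<exists>w. (\<forall>a. 0 < w a \<and> w a \<le> 1) \<and>
    (\<forall>f\<in>K. \<forall>\<epsilon>>0. finite {a\<in>B. \<epsilon> \<le> w a * (\<bar>blinfun_apply f a\<bar> / norm a)})"
    by (intro null_weights[where C = C and G = B] countable_C u compose_proj_continuous order_refl)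
  then obtain w where w: "\<And>a. 0 < w a"
    and fin: "\<And>f \<epsilon>. f \<in> K \<Longrightarrow> \<epsilon> > 0 \<Longrightarrow> finite {a\<in>B. \<epsilon> \<le> w a * (\<bar>blinfun_apply f a\<bar> / norm a)}"
    by metis
  \<comment> \<open>Dividing by the norm matches the normalization
    \<open>\<bar>blinfun_apply f a\<bar> / norm a\<close>, which is bounded by 1 on
    \<open>K\<close>.\<close>
  define y where "y a = (w a / norm a) *\<^sub>R a" for a
  have y: "\<bar>blinfun_apply f (y a)\<bar> = w a * (\<bar>blinfun_apply f a\<bar> / norm a)"
    for f :: "'a \<Rightarrow>\<^sub>L real" and a
    using w[of a] by (simp add: y_def blinfun.scaleR_right abs_mult)
  have "finite {z\<in>y ` B. \<epsilon> \<le> \<bar>blinfun_apply f z\<bar>}" if "\<epsilon> > 0" for f :: "'a \<Rightarrow>\<^sub>L real" and \<epsilon>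
  proof -
    \<comment> \<open>Scales \<open>f\<close> into the ball of radius \<open>c\<close>, which lies
      in \<open>K\<close>; the summand 1 covers \<open>f = 0\<close>.\<close>
    define t where "t = c / (norm f + 1)"
    have t: "t > 0" using c_pos by (simp add: t_def add_nonneg_pos)
    have "norm (t *\<^sub>R f) \<le> c"
    proof -
      have "norm f + 1 \<noteq> 0" using norm_ge_zero[of f] by linarith
      then have "t * (norm f + 1) = c" by (simp add: t_def)
      moreover have "t * norm f \<le> t * (norm f + 1)" using t by (intro mult_left_mono) auto
      ultimately show ?thesis using t by simp
    qed
    then have "finite {a\<in>B. t * \<epsilon> \<le> w a * (\<bar>blinfun_apply (t *\<^sub>R f) a\<bar> / norm a)}"
      using t that by (intro fin cball_subset_K) auto
    moreover have "t * \<epsilon> \<le> w a * (\<bar>blinfun_apply (t *\<^sub>R f) a\<bar> / norm a) \<longleftrightarrow> \<epsilon> \<le> \<bar>blinfun_apply f (y a)\<bar>" for a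
      unfolding y[symmetric] using t by (simp add: blinfun.scaleR_left abs_mult)
    ultimately have "finite {a\<in>B. \<epsilon> \<le> \<bar>blinfun_apply f (y a)\<bar>}" by simp
    then have "finite (y ` {a\<in>B. \<epsilon> \<le> \<bar>blinfun_apply f (y a)\<bar>})" by simp
    moreover have "{z\<in>y ` B. \<epsilon> \<le> \<bar>blinfun_apply f z\<bar>} = y ` {a\<in>B. \<epsilon> \<le> \<bar>blinfun_apply f (y a)\<bar>}" by auto
    ultimately show ?thesis by simp
  qed
  then have "compactin weak_topology (insert 0 (y ` B))"
    by (rule compactin_weak_insert_zero)
  moreover have "closure (span (insert 0 (y ` B))) = UNIV"
  proof -
    have "B \<subseteq> span (y ` B)"
    proof
      fix a assume a: "a \<in> B"
      then have "a \<noteq> 0" using indep dependent_zero by auto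
      then have "a = (norm a / w a) *\<^sub>R y a" using w[of a] by (simp add: y_def)
      moreover have "(norm a / w a) *\<^sub>R y a \<in> span (y ` B)"
        using a by (intro span_scale span_base) auto
      ultimately show "a \<in> span (y ` B)" by simp
    qed
    then have "span B \<subseteq> span (insert 0 (y ` B))"
      using span_minimal[OF _ subspace_span] span_mono[of "y ` B" "insert 0 (y ` B)"] by blast
    then show ?thesis using closure_mono dense by blast
  qed
  ultimately show ?thesis unfolding weakly_compactly_generated_def by blast
qed

end

section \<open>Reduction of a Plichko space to a norming basis\<close>

theorem theorem4p16:
  assumes "Plichko TYPE('a::banach)"
    and "Sz TYPE('a) < Fin omega_1"
  shows "weakly_compactly_generated TYPE('a)"
proof -
  obtain c and \<Gamma> :: "'a set" and e :: "'a \<Rightarrow> 'a" and \<phi>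
    where MB: "M_basis \<Gamma> e \<phi>" and nm: "norming c (countably_supported \<Gamma> e)"
    using assms(1) unfolding Plichko_def Plichko_const_def by blast
  have bi: "blinfun_apply (\<phi> \<alpha>) (e \<beta>) = (if \<alpha> = \<beta> then 1 else 0)" if "\<alpha> \<in> \<Gamma>" "\<beta> \<in> \<Gamma>" for \<alpha> \<beta>
    using MB that by (simp add: M_basis_def)
  have inj: "inj_on e \<Gamma>"
    using bi by (intro inj_onI) (metis zero_neq_one)
  have "independent (e ` \<Gamma>)"
    unfolding independent_explicit_module
  proof (intro allI impI)
    fix F u x assume F: "finite F" "F \<subseteq> e ` \<Gamma>" "(\<Sum>b\<in>F. u b *\<^sub>R b) = 0" "x \<in> F"
    obtain \<alpha> where \<alpha>: "\<alpha> \<in> \<Gamma>" "x = e \<alpha>" using F by blast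
    \<comment> \<open>The biorthogonal functional isolates the coefficient of
      \<open>e \<alpha>\<close> in the vanishing combination.\<close>
    have "0 = blinfun_apply (\<phi> \<alpha>) (\<Sum>b\<in>F. u b *\<^sub>R b)" by (simp add: F(3))
    also have "\<dots> = (\<Sum>b\<in>F. u b * blinfun_apply (\<phi> \<alpha>) b)"
      by (simp add: blinfun.sum_right blinfun.scaleR_right)
    also have "\<dots> = (\<Sum>b\<in>F. if b = x then u b else 0)"
      using F(2) \<alpha> bi inj by (intro sum.cong) (auto simp: inj_on_eq_iff)
    also have "\<dots> = u x" using F by simp
    finally show "u x = 0" by simp
  qed
  \<comment> \<open>The basis can be indexed by its own vectors because \<open>e\<close> is
    injective on \<open>\<Gamma>\<close>, so countability of supports is unchanged.\<close>
  moreover have "countably_supported (e ` \<Gamma>) id = countably_supported \<Gamma> e"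
  proof -
    have "{x \<in> e ` \<Gamma>. blinfun_apply f x \<noteq> 0} = e ` {\<alpha>\<in>\<Gamma>. blinfun_apply f (e \<alpha>) \<noteq> 0}" for f :: "'a \<Rightarrow>\<^sub>L real"
      by auto
    then show ?thesis
      unfolding countably_supported_def
      using countable_image_inj_eq[OF inj_on_subset[OF inj]] by simp
  qed
  ultimately have nb: "norming_basis (e ` \<Gamma>) c"
    using MB nm by unfold_locales (simp_all add: M_basis_def)
  have "\<exists>\<alpha> :: 'a szlenk_ordinal. countable {..<\<alpha>} \<and>
    szlenk_iter (inverse (real (Suc m))) (cball 0 1 :: ('a \<Rightarrow>\<^sub>L real) set) \<alpha> = {}" for m
    using Sz_countableD[OF assms(2), of "inverse (real (Suc m))"]
    by (metis inverse_positive_iff_positive of_nat_0_less_iff zero_less_Suc)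
  then obtain ht :: "nat \<Rightarrow> 'a szlenk_ordinal" where "\<And>m. countable {..<ht m}"
    "\<And>m. szlenk_iter (inverse (real (Suc m))) (cball 0 1 :: ('a \<Rightarrow>\<^sub>L real) set) (ht m) = {}"
    by metis
  then interpret szlenk_norming_basis "e ` \<Gamma>" c ht
    using nb by (intro szlenk_norming_basis.intro szlenk_norming_basis_axioms.intro)
  show ?thesis by (rule weakly_compactly_generated)
qed

end
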